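(* Let $R$ be a commutative ring with unit, let $\mathcal{A}$ be a set (alphabet), let $\mathcal{V}$ be the free $R$-module with basis the set of non-empty words in the alphabet $\mathcal{A}$, and let $L$ be a stable set of words in the alphabet $\mathcal{A}$. Let $\rho_L:\mathcal{V}\to\mathcal{V}\otimes\mathcal{V}$ be the $R$-linear map given on each non-empty word $w$ of length $m\geq 1$ by $$\rho_L(w)=\sum_{(i,j)} w_{i,j}\otimes w_{1,i}w_{j,m+1},$$ where the sum runs over all simple cuts $(i,j)$ of $w$, i.e., over all pairs of indices $1\le i<j\le m+1$ such that $(i,j)\ne(1,m+1)$ and $w_{i,j}\in L$. Then $\rho_L$ is a pre-Lie comultiplication in $\mathcal{V}$.
   Context: All tensor products are over $R$. A word of length $m\ge 0$ in the alphabet $\mathcal{A}$ is a finite sequence $w=w(1)w(2)\cdots w(m)$ of elements of $\mathcal{A}$; the word of length $0$ is the empty word. The concatenation of words $w,x$ is denoted $wx$. For a word $w$ of length $m\ge1$ and $1\le i\le j\le m+1$, set $w_{i,j}=w(i)w(i+1)\cdots w(j-1)$, a word of length $j-i$ (empty iff $i=j$). A set $L$ of non-empty words is stable if for any word $w$ of length $m\ge1$ and any indices $1\le i<j\le m+1$ such that $(i,j)\ne(1,m+1)$ and $w_{i,j}\in L$, the word $w$ belongs to $L$ if and only if the word $w_{1,i}w_{j,m+1}$ belongs to $L$. A comultiplication in an $R$-module $A$ is an $R$-linear map $\rho:A\to A\otimes A$; it is pre-Lie if $\tilde\rho=(\mathrm{id}_A\otimes\rho)\rho-(\rho\otimes\mathrm{id}_A)\rho$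 satisfies $P^{1,2}\tilde\rho(a)=\tilde\rho(a)$ for all $a\in A$, where $P^{1,2}$ is the endomorphism of $A\otimes A\otimes A$ sending $a\otimes b\otimes c$ to $b\otimes a\otimes c$. *)

theory Defs
  imports "HOL-Algebra.Module" "HOL-Algebra.AbelCoset"
begin

definition linear_maps ::
    "('r, 'q) ring_scheme \<Rightarrow> ('r, 'a, 'm) module_scheme \<Rightarrow> ('r, 'b, 'n) module_scheme \<Rightarrow> ('a \<Rightarrow> 'b) set"
  where "linear_maps R M N =
    {f. f \<in> carrier M \<rightarrow> carrier N \<and>
        (\<forall>x\<in>carrier M. \<forall>y\<in>carrier M. f (x \<oplus>\<^bsub>M\<^esub> y) = f x \<oplus>\<^bsub>N\<^esub> f y) \<and>
        (\<forall>r\<in>carrier R. \<forall>x\<in>carrier M. f (r \<odot>\<^bsub>M\<^esub> x) = r \<odot>\<^bsub>N\<^esub> f x)}"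

definition supp :: "('r, 'q) ring_scheme \<Rightarrow> ('x \<Rightarrow> 'r) \<Rightarrow> 'x set"
  where "supp R f = {x. f x \<noteq> \<zero>\<^bsub>R\<^esub>}"

text \<open>The record type of modules extends that of rings, but the fields \<open>mult\<close> and \<open>one\<close> play
  no role for a module; they are left unspecified in the constructions below.\<close>

definition free_module :: "('r, 'q) ring_scheme \<Rightarrow> 'x set \<Rightarrow> ('r, 'x \<Rightarrow> 'r) module"
  where "free_module R X =
    \<lparr>carrier = {f. range f \<subseteq> carrier R \<and> finite (supp R f) \<and> supp R f \<subseteq> X},
     mult = undefined, one = undefined,
     zero = (\<lambda>x. \<zero>\<^bsub>R\<^esub>),
     add = (\<lambda>f g x. f x \<oplus>\<^bsub>R\<^esub> g x),
     smult = (\<lambda>r f x. r \<otimes>\<^bsub>R\<^esub> f x)\<rparr>"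

definition basis_vec :: "('r, 'q) ring_scheme \<Rightarrow> 'x \<Rightarrow> 'x \<Rightarrow> 'r"
  where "basis_vec R x = (\<lambda>y. if y = x then \<one>\<^bsub>R\<^esub> else \<zero>\<^bsub>R\<^esub>)"

text \<open>On a free module, \<open>lin_ext R M \<phi>\<close> is the linear map into \<open>M\<close> taking the value \<open>\<phi> x\<close> at the
  basis vector of \<open>x\<close>.\<close>

definition lin_ext ::
    "('r, 'q) ring_scheme \<Rightarrow> ('r, 'a, 'm) module_scheme \<Rightarrow> ('x \<Rightarrow> 'a) \<Rightarrow> ('x \<Rightarrow> 'r) \<Rightarrow> 'a"
  where "lin_ext R M \<phi> f = (\<Oplus>\<^bsub>M\<^esub> x \<in> supp R f. f x \<odot>\<^bsub>M\<^esub> \<phi> x)"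

definition span_submodule ::
    "('r, 'q) ring_scheme \<Rightarrow> ('r, 'a, 'm) module_scheme \<Rightarrow> 'a set \<Rightarrow> 'a set"
  where "span_submodule R M S = \<Inter>{N. submodule N R M \<and> S \<subseteq> N}"

definition quot_module :: "('r, 'a, 'm) module_scheme \<Rightarrow> 'a set \<Rightarrow> ('r, 'a set) module"
  where "quot_module M N =
    \<lparr>carrier = a_rcosets\<^bsub>M\<^esub> N,
     mult = undefined, one = undefined,
     zero = N,
     add = set_add M,
     smult = (\<lambda>r K. \<Union>x\<in>K. N +>\<^bsub>M\<^esub> (r \<odot>\<^bsub>M\<^esub> x))\<rparr>"

text \<open>\<open>M \<otimes>\<^sub>R N\<close> is the quotient of the free module on \<open>M \<times> N\<close> by the bilinearity relations.\<close>

definition tensor_rels ::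
    "('r, 'q) ring_scheme \<Rightarrow> ('r, 'a, 'm) module_scheme \<Rightarrow> ('r, 'b, 'n) module_scheme
      \<Rightarrow> ('a \<times> 'b \<Rightarrow> 'r) set"
  where "tensor_rels R M N =
    (let F = free_module R (carrier M \<times> carrier N); d = (\<lambda>a b. basis_vec R (a, b)) in
      {d (a \<oplus>\<^bsub>M\<^esub> a') b \<ominus>\<^bsub>F\<^esub> (d a b \<oplus>\<^bsub>F\<^esub> d a' b) | a a' b.
          a \<in> carrier M \<and> a' \<in> carrier M \<and> b \<in> carrier N} \<union>
      {d a (b \<oplus>\<^bsub>N\<^esub> b') \<ominus>\<^bsub>F\<^esub> (d a b \<oplus>\<^bsub>F\<^esub> d a b') | a b b'.
          a \<in> carrier M \<and> b \<in> carrier N \<and> b' \<in> carrier N} \<union>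
      {d (r \<odot>\<^bsub>M\<^esub> a) b \<ominus>\<^bsub>F\<^esub> r \<odot>\<^bsub>F\<^esub> d a b | r a b.
          r \<in> carrier R \<and> a \<in> carrier M \<and> b \<in> carrier N} \<union>
      {d a (r \<odot>\<^bsub>N\<^esub> b) \<ominus>\<^bsub>F\<^esub> r \<odot>\<^bsub>F\<^esub> d a b | r a b.
          r \<in> carrier R \<and> a \<in> carrier M \<and> b \<in> carrier N})"

definition tensor_ker ::
    "('r, 'q) ring_scheme \<Rightarrow> ('r, 'a, 'm) module_scheme \<Rightarrow> ('r, 'b, 'n) module_scheme
      \<Rightarrow> ('a \<times> 'b \<Rightarrow> 'r) set"
  where "tensor_ker R M N =
    span_submodule R (free_module R (carrier M \<times> carrier N)) (tensor_rels R M N)"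

definition tensor ::
    "('r, 'q) ring_scheme \<Rightarrow> ('r, 'a, 'm) module_scheme \<Rightarrow> ('r, 'b, 'n) module_scheme
      \<Rightarrow> ('r, ('a \<times> 'b \<Rightarrow> 'r) set) module"
  where "tensor R M N =
    quot_module (free_module R (carrier M \<times> carrier N)) (tensor_ker R M N)"

definition pure_tensor ::
    "('r, 'q) ring_scheme \<Rightarrow> ('r, 'a, 'm) module_scheme \<Rightarrow> ('r, 'b, 'n) module_scheme
      \<Rightarrow> 'a \<Rightarrow> 'b \<Rightarrow> ('a \<times> 'b \<Rightarrow> 'r) set"
  where "pure_tensor R M N a b =
    tensor_ker R M N +>\<^bsub>free_module R (carrier M \<times> carrier N)\<^esub> basis_vec R (a, b)"

text \<open>For bilinear \<open>\<beta>\<close>, \<open>tensor_lift R P \<beta>\<close> is the linear map from the tensor product to \<open>P\<close> sending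
  \<open>a \<otimes> b\<close> to \<open>\<beta> a b\<close>; the chosen representative of a coset is then immaterial.\<close>

definition tensor_lift ::
    "('r, 'q) ring_scheme \<Rightarrow> ('r, 'c, 'p) module_scheme \<Rightarrow> ('a \<Rightarrow> 'b \<Rightarrow> 'c)
      \<Rightarrow> ('a \<times> 'b \<Rightarrow> 'r) set \<Rightarrow> 'c"
  where "tensor_lift R P \<beta> K = lin_ext R P (\<lambda>(a, b). \<beta> a b) (SOME f. f \<in> K)"

text \<open>\<open>tensor_map R M' N' f g\<close> is \<open>f \<otimes> g\<close> for \<open>f\<close> with codomain \<open>M'\<close> and \<open>g\<close> with codomain \<open>N'\<close>.\<close>

definition tensor_map ::
    "('r, 'q) ring_scheme \<Rightarrow> ('r, 'c, 'm) module_scheme \<Rightarrow> ('r, 'd, 'n) module_scheme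
      \<Rightarrow> ('a \<Rightarrow> 'c) \<Rightarrow> ('b \<Rightarrow> 'd) \<Rightarrow> ('a \<times> 'b \<Rightarrow> 'r) set \<Rightarrow> ('c \<times> 'd \<Rightarrow> 'r) set"
  where "tensor_map R M' N' f g =
    tensor_lift R (tensor R M' N') (\<lambda>a b. pure_tensor R M' N' (f a) (g b))"

text \<open>The threefold tensor product is bracketed to the right; \<open>tensor_assoc\<close> is the canonical
  isomorphism onto it from the left bracketing, \<open>(a \<otimes> b) \<otimes> c \<mapsto> a \<otimes> (b \<otimes> c)\<close>.\<close>

definition tensor3 ::
    "('r, 'q) ring_scheme \<Rightarrow> ('r, 'a, 'm) module_scheme
      \<Rightarrow> ('r, ('a \<times> ('a \<times> 'a \<Rightarrow> 'r) set \<Rightarrow> 'r) set) module"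
  where "tensor3 R A = tensor R A (tensor R A A)"

definition pure_tensor3 ::
    "('r, 'q) ring_scheme \<Rightarrow> ('r, 'a, 'm) module_scheme \<Rightarrow> 'a \<Rightarrow> 'a \<Rightarrow> 'a
      \<Rightarrow> ('a \<times> ('a \<times> 'a \<Rightarrow> 'r) set \<Rightarrow> 'r) set"
  where "pure_tensor3 R A a b c = pure_tensor R A (tensor R A A) a (pure_tensor R A A b c)"

definition tensor_assoc ::
    "('r, 'q) ring_scheme \<Rightarrow> ('r, 'a, 'm) module_scheme
      \<Rightarrow> (('a \<times> 'a \<Rightarrow> 'r) set \<times> 'a \<Rightarrow> 'r) set \<Rightarrow> ('a \<times> ('a \<times> 'a \<Rightarrow> 'r) set \<Rightarrow> 'r) set"
  where "tensor_assoc R A =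
    tensor_lift R (tensor3 R A)
      (\<lambda>t c. tensor_lift R (tensor3 R A) (\<lambda>a b. pure_tensor3 R A a b c) t)"

definition swap12 ::
    "('r, 'q) ring_scheme \<Rightarrow> ('r, 'a, 'm) module_scheme
      \<Rightarrow> ('a \<times> ('a \<times> 'a \<Rightarrow> 'r) set \<Rightarrow> 'r) set \<Rightarrow> ('a \<times> ('a \<times> 'a \<Rightarrow> 'r) set \<Rightarrow> 'r) set"
  where "swap12 R A =
    tensor_lift R (tensor3 R A)
      (\<lambda>a t. tensor_lift R (tensor3 R A) (\<lambda>b c. pure_tensor3 R A b a c) t)"

definition comultiplication ::
    "('r, 'q) ring_scheme \<Rightarrow> ('r, 'a, 'm) module_scheme \<Rightarrow> ('a \<Rightarrow> ('a \<times> 'a \<Rightarrow> 'r) set) \<Rightarrow> bool"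
  where "comultiplication R A \<rho> \<longleftrightarrow> module R A \<and> \<rho> \<in> linear_maps R A (tensor R A A)"

definition coassociator ::
    "('r, 'q) ring_scheme \<Rightarrow> ('r, 'a, 'm) module_scheme \<Rightarrow> ('a \<Rightarrow> ('a \<times> 'a \<Rightarrow> 'r) set)
      \<Rightarrow> 'a \<Rightarrow> ('a \<times> ('a \<times> 'a \<Rightarrow> 'r) set \<Rightarrow> 'r) set"
  where "coassociator R A \<rho> a =
    tensor_map R A (tensor R A A) (\<lambda>x. x) \<rho> (\<rho> a)
      \<ominus>\<^bsub>tensor3 R A\<^esub> tensor_assoc R A (tensor_map R (tensor R A A) A \<rho> (\<lambda>x. x) (\<rho> a))"

definition pre_Lie_comultiplication ::
    "('r, 'q) ring_scheme \<Rightarrow> ('r, 'a, 'm) module_scheme \<Rightarrow> ('a \<Rightarrow> ('a \<times> 'a \<Rightarrow> 'r) set) \<Rightarrow> bool"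
  where "pre_Lie_comultiplication R A \<rho> \<longleftrightarrow>
    comultiplication R A \<rho> \<and>
    (\<forall>a\<in>carrier A. swap12 R A (coassociator R A \<rho> a) = coassociator R A \<rho> a)"

definition nonempty_words :: "'a set \<Rightarrow> 'a list set"
  where "nonempty_words \<A> = lists \<A> - {[]}"

text \<open>Positions in a word are counted from \<open>1\<close>: \<open>subword w i j\<close> is \<open>w(i) \<dots> w(j-1)\<close>.\<close>

definition subword :: "'a list \<Rightarrow> nat \<Rightarrow> nat \<Rightarrow> 'a list"
  where "subword w i j = take (j - i) (drop (i - 1) w)"

definition remaining_word :: "'a list \<Rightarrow> nat \<Rightarrow> nat \<Rightarrow> 'a list"
  where "remaining_word w i j = subword w 1 i @ subword w j (length w + 1)"

definition simple_cuts :: "'a list set \<Rightarrow> 'a list \<Rightarrow> (nat \<times> nat) set"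
  where "simple_cuts L w =
    {(i, j). 1 \<le> i \<and> i < j \<and> j \<le> length w + 1 \<and> (i, j) \<noteq> (1, length w + 1) \<and> subword w i j \<in> L}"

definition stable_set :: "'a set \<Rightarrow> 'a list set \<Rightarrow> bool"
  where "stable_set \<A> L \<longleftrightarrow>
    L \<subseteq> nonempty_words \<A> \<and>
    (\<forall>w\<in>nonempty_words \<A>. \<forall>(i, j)\<in>simple_cuts L w. w \<in> L \<longleftrightarrow> remaining_word w i j \<in> L)"

definition word_module :: "('r, 'q) ring_scheme \<Rightarrow> 'a set \<Rightarrow> ('r, 'a list \<Rightarrow> 'r) module"
  where "word_module R \<A> = free_module R (nonempty_words \<A>)"

definition rho ::
    "('r, 'q) ring_scheme \<Rightarrow> 'a set \<Rightarrow> 'a list set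
      \<Rightarrow> ('a list \<Rightarrow> 'r) \<Rightarrow> (('a list \<Rightarrow> 'r) \<times> ('a list \<Rightarrow> 'r) \<Rightarrow> 'r) set"
  where "rho R \<A> L =
    (let V = word_module R \<A>; VV = tensor R V V in
      lin_ext R VV (\<lambda>w. \<Oplus>\<^bsub>VV\<^esub> c \<in> simple_cuts L w. case c of (i, j) \<Rightarrow>
        pure_tensor R V V (basis_vec R (subword w i j)) (basis_vec R (remaining_word w i j))))"

end

theory Submission
  imports Defs
begin

text \<open>On a word \<open>w\<close>, \<open>(id \<otimes> \<rho>) \<rho>\<close> removes a factor \<open>u \<in> L\<close> from \<open>w\<close> and then a factor
  \<open>u' \<in> L\<close> from the remainder. Either \<open>u\<close> and \<open>u'\<close> are disjoint factors of \<open>w\<close>, or \<open>u' = x y\<close>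
  straddles the gap left by \<open>u\<close>. By stability \<open>x u y \<in> L\<close> in the second case, so these terms are
  exactly those of \<open>(\<rho> \<otimes> id) \<rho>\<close> in which the factor \<open>u\<close> lies strictly inside the removed factor,
  and they cancel in the coassociator. What is left is symmetric in the first two tensor slots: the ordered
  pairs of disjoint factors and, in \<open>(\<rho> \<otimes> id) \<rho>\<close>, the splittings of a removed factor \<open>u v\<close> into
  a prefix and a suffix, where stability puts one of \<open>u\<close>, \<open>v\<close> in \<open>L\<close> as soon as the other is,
  so that either may be split off first.\<close>

section \<open>Linear maps and free modules\<close>

text \<open>A map out of the tensor product is evaluated at a chosen representative of a coset, so
  identities cannot be computed straight from the definitions. Both halves of the universal property
  come in between: every map in the coassociator is used only through its linearity and its values
  on pure tensors, and the pre-Lie identity, being linear, is tested on single words.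

  On a word, index cuts are replaced by factorisations, which turns position arithmetic into
  equations between concatenations while keeping equal factors at different places apart. A pair of
  removed factors is indexed once, in its left-to-right order, and contributes both orders of the
  first two slots. Every surviving term thus has the form \<open>T u v x\<close> plus
  \<open>T v u x\<close> and is symmetric by itself, with no division by 2 and no involution on the
  index set. The ban on cutting out the whole word does not disturb the cancellation: for a
  cancelling pair both iterated cuts require exactly that the final remainder \<open>p @ s\<close>
  be non-empty, as \<open>x @ y\<close> is non-empty anyway.\<close>

lemma linear_mapsI:
  assumes "\<And>x. x \<in> carrier M \<Longrightarrow> f x \<in> carrier N"
    and "\<And>x y. \<lbrakk>x \<in> carrier M; y \<in> carrier M\<rbrakk> \<Longrightarrow> f (x \<oplus>\<^bsub>M\<^esub> y) = f x \<oplus>\<^bsub>N\<^esub> f y"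
    and "\<And>r x. \<lbrakk>r \<in> carrier R; x \<in> carrier M\<rbrakk> \<Longrightarrow> f (r \<odot>\<^bsub>M\<^esub> x) = r \<odot>\<^bsub>N\<^esub> f x"
  shows "f \<in> linear_maps R M N"
  using assms by (simp add: linear_maps_def)

lemma linear_maps_closed: "f \<in> linear_maps R M N \<Longrightarrow> x \<in> carrier M \<Longrightarrow> f x \<in> carrier N"
  and linear_maps_add:
    "f \<in> linear_maps R M N \<Longrightarrow> x \<in> carrier M \<Longrightarrow> y \<in> carrier M \<Longrightarrow>
      f (x \<oplus>\<^bsub>M\<^esub> y) = f x \<oplus>\<^bsub>N\<^esub> f y"
  and linear_maps_smult:
    "f \<in> linear_maps R M N \<Longrightarrow> r \<in> carrier R \<Longrightarrow> x \<in> carrier M \<Longrightarrow>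
      f (r \<odot>\<^bsub>M\<^esub> x) = r \<odot>\<^bsub>N\<^esub> f x"
  by (auto simp: linear_maps_def)

lemma linear_maps_id: "(\<lambda>x. x) \<in> linear_maps R M M"
  by (simp add: linear_maps_def)

lemma linear_maps_comp:
  "g \<in> linear_maps R N P \<Longrightarrow> f \<in> linear_maps R M N \<Longrightarrow> (\<lambda>x. g (f x)) \<in> linear_maps R M P"
  by (auto simp: linear_maps_def Pi_def)

lemma linear_maps_plus:
  assumes N: "module R N" and f: "f \<in> linear_maps R M N" and g: "g \<in> linear_maps R M N"
  shows "(\<lambda>x. f x \<oplus>\<^bsub>N\<^esub> g x) \<in> linear_maps R M N"
proof -
  interpret N: module R N by fact
  show ?thesis
    using linear_maps_closed[OF f] linear_maps_closed[OF g]
    by (intro linear_mapsI)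
      (simp_all add: linear_maps_add[OF f] linear_maps_add[OF g]
        linear_maps_smult[OF f] linear_maps_smult[OF g] N.smult_r_distr N.M.a_ac)
qed

text \<open>Homogeneity of the scaled map moves two scalars past each other, so it rests on
  commutativity of \<open>R\<close>.\<close>

lemma linear_maps_scale:
  assumes N: "module R N" and f: "f \<in> linear_maps R M N" and r: "r \<in> carrier R"
  shows "(\<lambda>x. r \<odot>\<^bsub>N\<^esub> f x) \<in> linear_maps R M N"
proof -
  interpret N: module R N by fact
  show ?thesis
    using linear_maps_closed[OF f] r
    by (intro linear_mapsI)
      (simp_all add: linear_maps_add[OF f] linear_maps_smult[OF f] N.smult_r_distr
        N.smult_assoc1[symmetric] N.R.m_comm)
qed

lemma linear_maps_zero:
  assumes M: "module R M" and N: "module R N" and f: "f \<in> linear_maps R M N"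
  shows "f \<zero>\<^bsub>M\<^esub> = \<zero>\<^bsub>N\<^esub>"
proof -
  interpret M: module R M by fact
  interpret N: module R N by fact
  have "f (\<zero>\<^bsub>R\<^esub> \<odot>\<^bsub>M\<^esub> \<zero>\<^bsub>M\<^esub>) = \<zero>\<^bsub>R\<^esub> \<odot>\<^bsub>N\<^esub> f \<zero>\<^bsub>M\<^esub>"
    by (rule linear_maps_smult[OF f]) simp_all
  then show ?thesis
    using linear_maps_closed[OF f, of "\<zero>\<^bsub>M\<^esub>"] by simp
qed

lemma linear_maps_minus:
  assumes M: "module R M" and N: "module R N" and f: "f \<in> linear_maps R M N"
    and x: "x \<in> carrier M" and y: "y \<in> carrier M"
  shows "f (x \<ominus>\<^bsub>M\<^esub> y) = f x \<ominus>\<^bsub>N\<^esub> f y"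
proof -
  interpret M: module R M by fact
  interpret N: module R N by fact
  have "f (\<ominus>\<^bsub>R\<^esub> \<one>\<^bsub>R\<^esub> \<odot>\<^bsub>M\<^esub> y) = \<ominus>\<^bsub>R\<^esub> \<one>\<^bsub>R\<^esub> \<odot>\<^bsub>N\<^esub> f y"
    by (rule linear_maps_smult[OF f]) (simp_all add: y)
  then have "f (\<ominus>\<^bsub>M\<^esub> y) = \<ominus>\<^bsub>N\<^esub> f y"
    using linear_maps_closed[OF f y] y by (simp add: M.smult_l_minus N.smult_l_minus)
  then show ?thesis
    using x y by (simp add: a_minus_def linear_maps_add[OF f])
qed

lemma linear_maps_diff:
  assumes M: "module R M" and N: "module R N"
    and f: "f \<in> linear_maps R M N" and g: "g \<in> linear_maps R M N"
  shows "(\<lambda>x. f x \<ominus>\<^bsub>N\<^esub> g x) \<in> linear_maps R M N"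
proof -
  interpret M: module R M by fact
  interpret N: module R N by fact
  have "(\<lambda>x. f x \<oplus>\<^bsub>N\<^esub> (\<ominus>\<^bsub>R\<^esub> \<one>\<^bsub>R\<^esub>) \<odot>\<^bsub>N\<^esub> g x) \<in> linear_maps R M N"
    by (intro linear_maps_plus N f linear_maps_scale g) simp
  \<comment> \<open>The two functions agree on the carrier, and membership in
    \<open>linear_maps\<close> looks no further.\<close>
  moreover have "f x \<oplus>\<^bsub>N\<^esub> (\<ominus>\<^bsub>R\<^esub> \<one>\<^bsub>R\<^esub>) \<odot>\<^bsub>N\<^esub> g x = f x \<ominus>\<^bsub>N\<^esub> g x" if "x \<in> carrier M" for x
    using linear_maps_closed[OF g that] by (simp add: N.smult_l_minus a_minus_def)
  ultimately show ?thesis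
    by (simp add: linear_maps_def Pi_def)
qed

lemma linear_maps_finsum:
  assumes M: "module R M" and N: "module R N" and f: "f \<in> linear_maps R M N"
    and fin: "finite A" and g: "g \<in> A \<rightarrow> carrier M"
  shows "f (\<Oplus>\<^bsub>M\<^esub> x\<in>A. g x) = (\<Oplus>\<^bsub>N\<^esub> x\<in>A. f (g x))"
proof -
  interpret M: module R M by fact
  interpret N: module R N by fact
  show ?thesis using fin g
  proof (induction A rule: finite_induct)
    case empty
    show ?case by (simp add: linear_maps_zero[OF M N f])
  next
    case (insert x A)
    then have "g \<in> A \<rightarrow> carrier M" "g x \<in> carrier M" "(\<lambda>x. f (g x)) \<in> A \<rightarrow> carrier N"
      using linear_maps_closed[OF f] by (auto simp: Pi_def)
    with insert show ?case
      by (simp add: linear_maps_add[OF f] linear_maps_closed[OF f])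
  qed
qed

section \<open>Free modules: basis expansion and linear extension\<close>

lemma free_module_simps:
  "carrier (free_module R X) = {f. range f \<subseteq> carrier R \<and> finite (supp R f) \<and> supp R f \<subseteq> X}"
  "\<zero>\<^bsub>free_module R X\<^esub> = (\<lambda>x. \<zero>\<^bsub>R\<^esub>)"
  "f \<oplus>\<^bsub>free_module R X\<^esub> g = (\<lambda>x. f x \<oplus>\<^bsub>R\<^esub> g x)"
  "r \<odot>\<^bsub>free_module R X\<^esub> f = (\<lambda>x. r \<otimes>\<^bsub>R\<^esub> f x)"
  by (simp_all add: free_module_def)

lemma free_module_carrierD:
  assumes "f \<in> carrier (free_module R X)"
  shows "range f \<subseteq> carrier R" "finite (supp R f)" "supp R f \<subseteq> X" "f x \<in> carrier R"
  using assms by (auto simp: free_module_simps)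

lemma (in cring) free_module_module: "module R (free_module R X)"
proof (rule moduleI)
  show "abelian_group (free_module R X)"
  proof (rule abelian_groupI)
    fix f g assume "f \<in> carrier (free_module R X)" "g \<in> carrier (free_module R X)"
    moreover have "supp R (\<lambda>x. f x \<oplus> g x) \<subseteq> supp R f \<union> supp R g"
      by (auto simp: supp_def)
    ultimately show "f \<oplus>\<^bsub>free_module R X\<^esub> g \<in> carrier (free_module R X)"
      by (auto simp: free_module_simps image_subset_iff intro: finite_subset)
  next
    fix f assume f: "f \<in> carrier (free_module R X)"
    have "supp R (\<lambda>x. \<ominus> f x) \<subseteq> supp R f"
      by (auto simp: supp_def)
    with f show "\<exists>g\<in>carrier (free_module R X). g \<oplus>\<^bsub>free_module R X\<^esub> f = \<zero>\<^bsub>free_module R X\<^esub>"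
      by (intro bexI[of _ "\<lambda>x. \<ominus> f x"])
        (auto simp: free_module_simps image_subset_iff l_neg intro: finite_subset)
  qed (auto simp: free_module_simps image_subset_iff supp_def fun_eq_iff a_ac)
next
  fix r f assume "r \<in> carrier R" "f \<in> carrier (free_module R X)"
  moreover from this have "supp R (\<lambda>x. r \<otimes> f x) \<subseteq> supp R f"
    by (auto simp: supp_def)
  ultimately show "r \<odot>\<^bsub>free_module R X\<^esub> f \<in> carrier (free_module R X)"
    by (auto simp: free_module_simps image_subset_iff intro: finite_subset)
qed (use is_cring in \<open>auto simp: free_module_simps image_subset_iff fun_eq_iff l_distr r_distr m_assoc\<close>)

lemma (in cring) basis_vec_closed: "x \<in> X \<Longrightarrow> basis_vec R x \<in> carrier (free_module R X)"
  by (auto simp: free_module_simps basis_vec_def supp_def intro: finite_subset[of _ "{x}"])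

lemma (in cring) free_module_expansion:
  assumes f: "f \<in> carrier (free_module R X)"
  shows "f = (\<Oplus>\<^bsub>free_module R X\<^esub> x\<in>supp R f. f x \<odot>\<^bsub>free_module R X\<^esub> basis_vec R x)"
proof
  fix y
  interpret F: module R "free_module R X" by (rule free_module_module)
  have fR: "f x \<in> carrier R" for x
    using free_module_carrierD[OF f] by simp
  \<comment> \<open>The claim is generalised to partial sums over a finite \<open>S\<close> with the
    coefficients of \<open>f\<close> kept fixed; an induction over the support itself would have to
    change \<open>f\<close>.\<close>
  have *: "(\<Oplus>\<^bsub>free_module R X\<^esub> x\<in>S. f x \<odot>\<^bsub>free_module R X\<^esub> basis_vec R x) y
      = (if y \<in> S then f y else \<zero>)" if "finite S" "S \<subseteq> X" for S
    using that
  proof (induction S rule: finite_induct)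
    case empty
    show ?case by (simp add: free_module_simps)
  next
    case (insert x S)
    then have "(\<lambda>x. f x \<odot>\<^bsub>free_module R X\<^esub> basis_vec R x) \<in> insert x S \<rightarrow> carrier (free_module R X)"
      by (intro Pi_I F.smult_closed[OF fR] basis_vec_closed) auto
    then have "(\<Oplus>\<^bsub>free_module R X\<^esub> x\<in>insert x S. f x \<odot>\<^bsub>free_module R X\<^esub> basis_vec R x)
      = f x \<odot>\<^bsub>free_module R X\<^esub> basis_vec R x
        \<oplus>\<^bsub>free_module R X\<^esub> (\<Oplus>\<^bsub>free_module R X\<^esub> x\<in>S. f x \<odot>\<^bsub>free_module R X\<^esub> basis_vec R x)"
      using insert.hyps by (simp add: F.finsum_insert)
    with insert show ?case
      using fR by (simp add: free_module_simps(3,4)) (auto simp: basis_vec_def)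
  qed
  show "f y = (\<Oplus>\<^bsub>free_module R X\<^esub> x\<in>supp R f. f x \<odot>\<^bsub>free_module R X\<^esub> basis_vec R x) y"
    using f by (subst *) (auto simp: free_module_simps supp_def)
qed

lemma free_module_ext:
  assumes M: "module R M"
    and f: "f \<in> linear_maps R (free_module R X) M" and g: "g \<in> linear_maps R (free_module R X) M"
    and eq: "\<And>x. x \<in> X \<Longrightarrow> f (basis_vec R x) = g (basis_vec R x)"
    and v: "v \<in> carrier (free_module R X)"
  shows "f v = g v"
proof -
  interpret M: module R M by fact
  let ?F = "free_module R X"
  let ?t = "\<lambda>x. v x \<odot>\<^bsub>?F\<^esub> basis_vec R x"
  interpret F: module R ?F by (rule M.free_module_module)
  have fin: "finite (supp R v)" and sub: "supp R v \<subseteq> X" and vR: "v x \<in> carrier R" for x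
    by (rule free_module_carrierD[OF v])+
  have b: "basis_vec R x \<in> carrier ?F" if "x \<in> supp R v" for x
    by (rule M.basis_vec_closed[OF subsetD[OF sub that]])
  have t: "?t \<in> supp R v \<rightarrow> carrier ?F"
    using b vR by (simp add: Pi_def)
  have fg: "f (?t x) = g (?t x)" if "x \<in> supp R v" for x
    using eq[of x] that sub
    by (simp add: linear_maps_smult[OF f vR b] linear_maps_smult[OF g vR b] subset_iff)
  have "(\<Oplus>\<^bsub>M\<^esub> x\<in>supp R v. f (?t x)) = (\<Oplus>\<^bsub>M\<^esub> x\<in>supp R v. g (?t x))"
    using t linear_maps_closed[OF g]
    by (intro M.add.finprod_cong' refl fg) (simp_all add: Pi_def)
  then have "f (\<Oplus>\<^bsub>?F\<^esub> x\<in>supp R v. ?t x) = g (\<Oplus>\<^bsub>?F\<^esub> x\<in>supp R v. ?t x)"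
    by (simp only: linear_maps_finsum[OF F.module_axioms M f fin t]
        linear_maps_finsum[OF F.module_axioms M g fin t])
  then show ?thesis
    using M.free_module_expansion[OF v] by simp
qed

text \<open>The support of a sum or a multiple can shrink through cancellation or zero divisors, so
  the sums behind \<open>lin_ext\<close> at different arguments run over different sets. Padding
  with zero terms gives them a common index set.\<close>

lemma lin_ext_superset:
  assumes M: "module R M" and \<phi>: "\<phi> \<in> X \<rightarrow> carrier M"
    and f: "range f \<subseteq> carrier R" and S: "finite S" "supp R f \<subseteq> S" "S \<subseteq> X"
  shows "lin_ext R M \<phi> f = (\<Oplus>\<^bsub>M\<^esub> x\<in>S. f x \<odot>\<^bsub>M\<^esub> \<phi> x)"
proof -
  interpret M: module R M by fact
  show ?thesis unfolding lin_ext_def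
    using \<phi> f S
    by (intro M.add.finprod_mono_neutral_cong_left)
      (auto simp: supp_def Pi_def subset_iff image_subset_iff)
qed

lemma lin_ext_linear:
  assumes M: "module R M" and \<phi>: "\<phi> \<in> X \<rightarrow> carrier M"
  shows "lin_ext R M \<phi> \<in> linear_maps R (free_module R X) M"
proof -
  interpret M: module R M by fact
  let ?F = "free_module R X"
  interpret F: module R ?F by (rule M.free_module_module)
  have D: "range f \<subseteq> carrier R" "finite (supp R f)" "supp R f \<subseteq> X" "f x \<in> carrier R"
    if "f \<in> carrier ?F" for f x
    by (rule free_module_carrierD[OF that])+
  show ?thesis
  proof (rule linear_mapsI)
    fix f assume "f \<in> carrier ?F"
    then show "lin_ext R M \<phi> f \<in> carrier M"
      using D[of f] \<phi> unfolding lin_ext_def by (intro M.finsum_closed) (auto simp: Pi_def)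
  next
    fix f g assume f: "f \<in> carrier ?F" and g: "g \<in> carrier ?F"
    let ?S = "supp R f \<union> supp R g"
    have fg: "f \<oplus>\<^bsub>?F\<^esub> g \<in> carrier ?F" using f g by simp
    have S: "finite ?S" "?S \<subseteq> X" "supp R (f \<oplus>\<^bsub>?F\<^esub> g) \<subseteq> ?S"
      using D[OF f] D[OF g] by (auto simp: free_module_simps supp_def)
    have "lin_ext R M \<phi> (f \<oplus>\<^bsub>?F\<^esub> g) = (\<Oplus>\<^bsub>M\<^esub> x\<in>?S. (f \<oplus>\<^bsub>?F\<^esub> g) x \<odot>\<^bsub>M\<^esub> \<phi> x)"
      by (rule lin_ext_superset[OF M \<phi> D(1)[OF fg] S(1,3,2)])
    also have "\<dots> = (\<Oplus>\<^bsub>M\<^esub> x\<in>?S. f x \<odot>\<^bsub>M\<^esub> \<phi> x \<oplus>\<^bsub>M\<^esub> g x \<odot>\<^bsub>M\<^esub> \<phi> x)"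
      using \<phi> S(2) D(4)[OF f] D(4)[OF g]
      by (intro M.add.finprod_cong') (auto simp: free_module_simps(3) M.smult_l_distr Pi_def subset_iff)
    also have "\<dots> = (\<Oplus>\<^bsub>M\<^esub> x\<in>?S. f x \<odot>\<^bsub>M\<^esub> \<phi> x) \<oplus>\<^bsub>M\<^esub> (\<Oplus>\<^bsub>M\<^esub> x\<in>?S. g x \<odot>\<^bsub>M\<^esub> \<phi> x)"
      using \<phi> S(2) D(4)[OF f] D(4)[OF g]
      by (intro M.finsum_addf) (auto simp: Pi_def subset_iff)
    also have "\<dots> = lin_ext R M \<phi> f \<oplus>\<^bsub>M\<^esub> lin_ext R M \<phi> g"
      using lin_ext_superset[OF M \<phi> D(1)[OF f], of ?S] lin_ext_superset[OF M \<phi> D(1)[OF g], of ?S] S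
      by simp
    finally show "lin_ext R M \<phi> (f \<oplus>\<^bsub>?F\<^esub> g) = lin_ext R M \<phi> f \<oplus>\<^bsub>M\<^esub> lin_ext R M \<phi> g" .
  next
    fix r f assume r: "r \<in> carrier R" and f: "f \<in> carrier ?F"
    have rf: "r \<odot>\<^bsub>?F\<^esub> f \<in> carrier ?F" using r f by simp
    have S: "supp R (r \<odot>\<^bsub>?F\<^esub> f) \<subseteq> supp R f"
      using r by (auto simp: free_module_simps supp_def)
    have "lin_ext R M \<phi> (r \<odot>\<^bsub>?F\<^esub> f) = (\<Oplus>\<^bsub>M\<^esub> x\<in>supp R f. (r \<odot>\<^bsub>?F\<^esub> f) x \<odot>\<^bsub>M\<^esub> \<phi> x)"
      by (rule lin_ext_superset[OF M \<phi> D(1)[OF rf] D(2)[OF f] S D(3)[OF f]])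
    also have "\<dots> = (\<Oplus>\<^bsub>M\<^esub> x\<in>supp R f. r \<odot>\<^bsub>M\<^esub> (f x \<odot>\<^bsub>M\<^esub> \<phi> x))"
      using \<phi> r D(3,4)[OF f]
      by (intro M.add.finprod_cong') (auto simp: free_module_simps(4) M.smult_assoc1 Pi_def subset_iff)
    also have "\<dots> = r \<odot>\<^bsub>M\<^esub> lin_ext R M \<phi> f"
      unfolding lin_ext_def using \<phi> r D[OF f]
      by (intro M.finsum_smult_ldistr[symmetric]) (auto simp: Pi_def subset_iff)
    finally show "lin_ext R M \<phi> (r \<odot>\<^bsub>?F\<^esub> f) = r \<odot>\<^bsub>M\<^esub> lin_ext R M \<phi> f" .
  qed
qed

lemma lin_ext_basis_vec:
  assumes M: "module R M" and x: "\<phi> x \<in> carrier M"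
  shows "lin_ext R M \<phi> (basis_vec R x) = \<phi> x"
proof -
  interpret M: module R M by fact
  \<comment> \<open>Summing over \<open>{x}\<close> rather than over the support also covers the
    zero ring, in which the basis vector has empty support.\<close>
  have "lin_ext R M \<phi> (basis_vec R x) = (\<Oplus>\<^bsub>M\<^esub> y\<in>{x}. basis_vec R x y \<odot>\<^bsub>M\<^esub> \<phi> y)"
    using x by (intro lin_ext_superset[where X="{x}", OF M]) (auto simp: basis_vec_def supp_def)
  also have "\<dots> = \<phi> x"
    using x by (subst M.add.finprod_insert) (auto simp: basis_vec_def)
  finally show ?thesis .
qed

section \<open>Quotients and tensor products\<close>

lemma (in module) submodule_abelian_subgroup:
  assumes "submodule N R M"
  shows "abelian_subgroup N M"
  using submodule.axioms(1)[OF assms] M.abelian_group_axioms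
  by (intro abelian_subgroupI3 additive_subgroupI)

lemma quot_module_simps:
  "carrier (quot_module M N) = a_rcosets\<^bsub>M\<^esub> N"
  "\<zero>\<^bsub>quot_module M N\<^esub> = N"
  "K \<oplus>\<^bsub>quot_module M N\<^esub> K' = K <+>\<^bsub>M\<^esub> K'"
  "r \<odot>\<^bsub>quot_module M N\<^esub> K = (\<Union>x\<in>K. N +>\<^bsub>M\<^esub> (r \<odot>\<^bsub>M\<^esub> x))"
  by (simp_all add: quot_module_def)

text \<open>The union over all representatives in the definition collapses: changing
  \<open>x\<close> by an element \<open>n\<close> of \<open>N\<close> changes its multiple by the
  multiple of \<open>n\<close>, which lies in \<open>N\<close>, and \<open>x\<close> itself shows
  that the coset is non-empty.\<close>

lemma (in module) quot_module_smult_coset: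
  assumes N: "submodule N R M" and r: "r \<in> carrier R" and x: "x \<in> carrier M"
  shows "r \<odot>\<^bsub>quot_module M N\<^esub> (N +>\<^bsub>M\<^esub> x) = N +>\<^bsub>M\<^esub> (r \<odot>\<^bsub>M\<^esub> x)"
proof -
  interpret N: abelian_subgroup N M
    by (rule submodule_abelian_subgroup[OF N])
  have "N +>\<^bsub>M\<^esub> (r \<odot>\<^bsub>M\<^esub> z) = N +>\<^bsub>M\<^esub> (r \<odot>\<^bsub>M\<^esub> x)" if z: "z \<in> N +>\<^bsub>M\<^esub> x" for z
  proof -
    obtain n where n: "n \<in> N" "z = n \<oplus>\<^bsub>M\<^esub> x"
      using z by (auto simp: a_r_coset_def')
    have "r \<odot>\<^bsub>M\<^esub> z = r \<odot>\<^bsub>M\<^esub> n \<oplus>\<^bsub>M\<^esub> r \<odot>\<^bsub>M\<^esub> x"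
      using n r x by (simp add: smult_r_distr)
    moreover have "r \<odot>\<^bsub>M\<^esub> n \<in> N"
      by (rule submodule.smult_closed[OF N r n(1)])
    ultimately have "r \<odot>\<^bsub>M\<^esub> z \<in> N +>\<^bsub>M\<^esub> (r \<odot>\<^bsub>M\<^esub> x)"
      by (auto simp: a_r_coset_def')
    from N.a_repr_independence'[OF this smult_closed[OF r x]] show ?thesis
      by simp
  qed
  moreover have "x \<in> N +>\<^bsub>M\<^esub> x"
    by (rule N.a_rcos_self[OF x])
  ultimately show ?thesis
    unfolding quot_module_simps by blast
qed

lemma (in module) quot_module_module:
  assumes N: "submodule N R M"
  shows "module R (quot_module M N)"
proof -
  interpret N: abelian_subgroup N M
    by (rule submodule_abelian_subgroup[OF N])
  let ?Q = "quot_module M N"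
  \<comment> \<open>Every class has a representative, so each module axiom of the quotient reduces
    to the same axiom of \<open>M\<close>.\<close>
  have carr: "carrier ?Q = (\<lambda>x. N +>\<^bsub>M\<^esub> x) ` carrier M"
    by (auto simp: quot_module_simps A_RCOSETS_def')
  note sums = quot_module_simps(3) N.a_rcos_sum
  note smults = quot_module_smult_coset[OF N]
  show ?thesis
  proof (rule moduleI)
    show "cring R" by (rule R.is_cring)
    have zero: "\<zero>\<^bsub>?Q\<^esub> = N +>\<^bsub>M\<^esub> \<zero>\<^bsub>M\<^esub>"
      by (simp add: quot_module_simps M.a_coset_add_zero[OF N.a_subset])
    show "abelian_group ?Q"
    proof (rule abelian_groupI)
      fix K assume "K \<in> carrier ?Q"
      then obtain x where x: "x \<in> carrier M" "K = N +>\<^bsub>M\<^esub> x"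
        unfolding carr by blast
      then show "\<exists>K'\<in>carrier ?Q. K' \<oplus>\<^bsub>?Q\<^esub> K = \<zero>\<^bsub>?Q\<^esub>"
        unfolding carr zero
        by (intro bexI[of _ "N +>\<^bsub>M\<^esub> (\<ominus>\<^bsub>M\<^esub> x)"]) (simp_all add: sums M.l_neg)
    qed (unfold carr zero, auto simp: sums M.a_ac)
  next
    fix a K assume "a \<in> carrier R" "K \<in> carrier ?Q"
    then show "a \<odot>\<^bsub>?Q\<^esub> K \<in> carrier ?Q"
      unfolding carr by (elim imageE) (simp add: smults)
  next
    fix a b K assume "a \<in> carrier R" "b \<in> carrier R" "K \<in> carrier ?Q"
    then show "(a \<oplus> b) \<odot>\<^bsub>?Q\<^esub> K = a \<odot>\<^bsub>?Q\<^esub> K \<oplus>\<^bsub>?Q\<^esub> b \<odot>\<^bsub>?Q\<^esub> K"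
      unfolding carr by (elim imageE) (simp add: sums smults smult_l_distr)
  next
    fix a K K' assume "a \<in> carrier R" "K \<in> carrier ?Q" "K' \<in> carrier ?Q"
    then show "a \<odot>\<^bsub>?Q\<^esub> (K \<oplus>\<^bsub>?Q\<^esub> K') = a \<odot>\<^bsub>?Q\<^esub> K \<oplus>\<^bsub>?Q\<^esub> a \<odot>\<^bsub>?Q\<^esub> K'"
      unfolding carr by (elim imageE) (simp add: sums smults smult_r_distr)
  next
    fix a b K assume "a \<in> carrier R" "b \<in> carrier R" "K \<in> carrier ?Q"
    then show "(a \<otimes> b) \<odot>\<^bsub>?Q\<^esub> K = a \<odot>\<^bsub>?Q\<^esub> (b \<odot>\<^bsub>?Q\<^esub> K)"
      unfolding carr by (elim imageE) (simp add: smults smult_assoc1)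
  next
    fix K assume "K \<in> carrier ?Q"
    then show "\<one> \<odot>\<^bsub>?Q\<^esub> K = K"
      unfolding carr by (elim imageE) (simp add: smults)
  qed
qed

lemma (in module) quot_module_proj_linear:
  assumes N: "submodule N R M"
  shows "(\<lambda>x. N +>\<^bsub>M\<^esub> x) \<in> linear_maps R M (quot_module M N)"
proof -
  interpret N: abelian_subgroup N M
    by (rule submodule_abelian_subgroup[OF N])
  show ?thesis
    using quot_module_smult_coset[OF N]
    by (intro linear_mapsI) (auto simp: quot_module_simps N.a_rcos_sum A_RCOSETS_def')
qed

text \<open>The whole carrier is one of the submodules being intersected, because it contains
  \<open>S\<close>; this keeps the intersection inside the module.\<close>

lemma (in module) span_submodule_submodule:
  assumes "S \<subseteq> carrier M"
  shows "submodule (span_submodule R M S) R M"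
proof -
  have "\<zero>\<^bsub>M\<^esub> \<in> H" if "submodule H R M" for H
    using subgroup.one_closed[OF submodule.axioms(1)[OF that]] by simp
  then show ?thesis
    using assms carrier_is_submodule unfolding span_submodule_def
    by (intro submoduleI) (auto dest: submoduleE(1) intro: submoduleE(3-5))
qed

section \<open>The defining relations of the tensor product\<close>

lemma tensor_rels_intros:
  fixes R :: "('r, 'q) ring_scheme" and M :: "('r, 'a, 'm) module_scheme"
    and N :: "('r, 'b, 'n) module_scheme"
  defines "F \<equiv> free_module R (carrier M \<times> carrier N)"
  shows "\<lbrakk>a \<in> carrier M; a' \<in> carrier M; b \<in> carrier N\<rbrakk> \<Longrightarrow> basis_vec R (a \<oplus>\<^bsub>M\<^esub> a', b)
      \<ominus>\<^bsub>F\<^esub> (basis_vec R (a, b) \<oplus>\<^bsub>F\<^esub> basis_vec R (a', b)) \<in> tensor_rels R M N"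
    and "\<lbrakk>a \<in> carrier M; b \<in> carrier N; b' \<in> carrier N\<rbrakk> \<Longrightarrow> basis_vec R (a, b \<oplus>\<^bsub>N\<^esub> b')
      \<ominus>\<^bsub>F\<^esub> (basis_vec R (a, b) \<oplus>\<^bsub>F\<^esub> basis_vec R (a, b')) \<in> tensor_rels R M N"
    and "\<lbrakk>r \<in> carrier R; a \<in> carrier M; b \<in> carrier N\<rbrakk> \<Longrightarrow> basis_vec R (r \<odot>\<^bsub>M\<^esub> a, b)
      \<ominus>\<^bsub>F\<^esub> r \<odot>\<^bsub>F\<^esub> basis_vec R (a, b) \<in> tensor_rels R M N"
    and "\<lbrakk>r \<in> carrier R; a \<in> carrier M; b \<in> carrier N\<rbrakk> \<Longrightarrow> basis_vec R (a, r \<odot>\<^bsub>N\<^esub> b)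
      \<ominus>\<^bsub>F\<^esub> r \<odot>\<^bsub>F\<^esub> basis_vec R (a, b) \<in> tensor_rels R M N"
  unfolding F_def tensor_rels_def Let_def by blast+

lemma tensor_rels_closed:
  assumes M: "module R M" and N: "module R N"
  shows "tensor_rels R M N \<subseteq> carrier (free_module R (carrier M \<times> carrier N))"
proof -
  interpret M: module R M by fact
  interpret N: module R N by fact
  let ?F = "free_module R (carrier M \<times> carrier N)"
  interpret F: module R ?F by (rule M.free_module_module)
  have b: "basis_vec R (a, b) \<in> carrier ?F" if "a \<in> carrier M" "b \<in> carrier N" for a b
    using that by (intro M.basis_vec_closed) simp
  show ?thesis
    unfolding tensor_rels_def Let_def
    by (intro Un_least subsetI; elim CollectE exE conjE; hypsubst;
        intro F.minus_closed F.M.a_closed F.smult_closed b M.M.a_closed N.M.a_closed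
          M.smult_closed N.smult_closed; assumption)
qed

lemma tensor_ker_submodule:
  assumes M: "module R M" and N: "module R N"
  shows "submodule (tensor_ker R M N) R (free_module R (carrier M \<times> carrier N))"
proof -
  interpret M: module R M by fact
  show ?thesis unfolding tensor_ker_def
    by (intro module.span_submodule_submodule M.free_module_module tensor_rels_closed M N)
qed

lemma tensor_module:
  assumes M: "module R M" and N: "module R N"
  shows "module R (tensor R M N)"
proof -
  interpret M: module R M by fact
  show ?thesis unfolding tensor_def
    by (intro module.quot_module_module M.free_module_module tensor_ker_submodule M N)
qed

lemma tensor_proj_linear:
  assumes M: "module R M" and N: "module R N"
  shows "(\<lambda>v. tensor_ker R M N +>\<^bsub>free_module R (carrier M \<times> carrier N)\<^esub> v)
    \<in> linear_maps R (free_module R (carrier M \<times> carrier N)) (tensor R M N)"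
proof -
  interpret M: module R M by fact
  show ?thesis unfolding tensor_def
    by (intro module.quot_module_proj_linear M.free_module_module tensor_ker_submodule M N)
qed

text \<open>A general element is the class of a formal combination of pairs, not a pure tensor;
  arguments about all tensors start from such a representative.\<close>

lemma tensor_carrier:
  "carrier (tensor R M N) =
    (\<lambda>v. tensor_ker R M N +>\<^bsub>free_module R (carrier M \<times> carrier N)\<^esub> v)
      ` carrier (free_module R (carrier M \<times> carrier N))"
  by (auto simp: tensor_def quot_module_simps A_RCOSETS_def')

text \<open>Turns a defining relation, which is a difference, into an equality of cosets, the form
  in which bilinearity is needed.\<close>

lemma tensor_proj_rel:
  assumes M: "module R M" and N: "module R N"
    and x: "x \<in> carrier (free_module R (carrier M \<times> carrier N))"
    and y: "y \<in> carrier (free_module R (carrier M \<times> carrier N))"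
    and rel: "x \<ominus>\<^bsub>free_module R (carrier M \<times> carrier N)\<^esub> y \<in> tensor_rels R M N"
  shows "tensor_ker R M N +>\<^bsub>free_module R (carrier M \<times> carrier N)\<^esub> x
    = tensor_ker R M N +>\<^bsub>free_module R (carrier M \<times> carrier N)\<^esub> y"
proof -
  interpret M: module R M by fact
  let ?F = "free_module R (carrier M \<times> carrier N)"
  interpret F: module R ?F by (rule M.free_module_module)
  interpret K: abelian_subgroup "tensor_ker R M N" ?F
    by (rule F.submodule_abelian_subgroup[OF tensor_ker_submodule[OF M N]])
  have "x \<ominus>\<^bsub>?F\<^esub> y \<in> tensor_ker R M N"
    using rel unfolding tensor_ker_def span_submodule_def by blast
  then have "x \<in> tensor_ker R M N +>\<^bsub>?F\<^esub> y"
    using K.a_rcos_module[OF y x] by (simp add: a_minus_def)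
  from K.a_repr_independence'[OF this y] show ?thesis
    by simp
qed

section \<open>Bilinear maps and the universal property\<close>

definition bilinear_maps ::
    "('r, 'q) ring_scheme \<Rightarrow> ('r, 'a, 'm) module_scheme \<Rightarrow> ('r, 'b, 'n) module_scheme
      \<Rightarrow> ('r, 'c, 'p) module_scheme \<Rightarrow> ('a \<Rightarrow> 'b \<Rightarrow> 'c) set"
  where "bilinear_maps R M N P =
    {\<beta>. (\<forall>a\<in>carrier M. \<beta> a \<in> linear_maps R N P) \<and>
        (\<forall>b\<in>carrier N. (\<lambda>a. \<beta> a b) \<in> linear_maps R M P)}"

lemma bilinear_mapsI:
  assumes "\<And>a. a \<in> carrier M \<Longrightarrow> \<beta> a \<in> linear_maps R N P"
    and "\<And>b. b \<in> carrier N \<Longrightarrow> (\<lambda>a. \<beta> a b) \<in> linear_maps R M P"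
  shows "\<beta> \<in> bilinear_maps R M N P"
  using assms by (simp add: bilinear_maps_def)

lemma bilinear_maps_left: "\<beta> \<in> bilinear_maps R M N P \<Longrightarrow> b \<in> carrier N \<Longrightarrow> (\<lambda>a. \<beta> a b) \<in> linear_maps R M P"
  and bilinear_maps_right: "\<beta> \<in> bilinear_maps R M N P \<Longrightarrow> a \<in> carrier M \<Longrightarrow> \<beta> a \<in> linear_maps R N P"
  by (simp_all add: bilinear_maps_def)

lemma bilinear_maps_closed:
  "\<beta> \<in> bilinear_maps R M N P \<Longrightarrow> a \<in> carrier M \<Longrightarrow> b \<in> carrier N \<Longrightarrow> \<beta> a b \<in> carrier P"
  by (rule linear_maps_closed[OF bilinear_maps_right])

lemma bilinear_maps_comp:
  assumes \<beta>: "\<beta> \<in> bilinear_maps R M' N' P"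
    and f: "f \<in> linear_maps R M M'" and g: "g \<in> linear_maps R N N'"
  shows "(\<lambda>a b. \<beta> (f a) (g b)) \<in> bilinear_maps R M N P"
  by (intro bilinear_mapsI linear_maps_comp[OF bilinear_maps_right[OF \<beta>] g]
      linear_maps_comp[OF bilinear_maps_left[OF \<beta>] f] linear_maps_closed[OF f] linear_maps_closed[OF g])

text \<open>Each of the four families of relations supplies one of the four identities; the rest is
  linearity of the projection.\<close>

lemma pure_tensor_bilinear:
  assumes M: "module R M" and N: "module R N"
  shows "pure_tensor R M N \<in> bilinear_maps R M N (tensor R M N)"
proof -
  interpret M: module R M by fact
  interpret N: module R N by fact
  let ?F = "free_module R (carrier M \<times> carrier N)"
  let ?\<pi> = "\<lambda>v. tensor_ker R M N +>\<^bsub>?F\<^esub> v"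
  let ?d = "\<lambda>a b. basis_vec R (a, b)"
  interpret F: module R ?F by (rule M.free_module_module)
  note \<pi> = tensor_proj_linear[OF M N]
  note rel = tensor_proj_rel[OF M N]
  have b: "?d a b \<in> carrier ?F" if "a \<in> carrier M" "b \<in> carrier N" for a b
    using that by (intro M.basis_vec_closed) simp
  show ?thesis
    unfolding pure_tensor_def
  proof (intro bilinear_mapsI linear_mapsI)
    fix a b assume ab: "a \<in> carrier M" "b \<in> carrier N"
    then show "?\<pi> (?d a b) \<in> carrier (tensor R M N)" "?\<pi> (?d a b) \<in> carrier (tensor R M N)"
      by (simp_all add: linear_maps_closed[OF \<pi>] b)
    {
      fix b' assume b': "b' \<in> carrier N"
      have "?\<pi> (?d a (b \<oplus>\<^bsub>N\<^esub> b')) = ?\<pi> (?d a b \<oplus>\<^bsub>?F\<^esub> ?d a b')"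
        by (intro rel tensor_rels_intros F.M.a_closed b N.M.a_closed ab b')
      then show "?\<pi> (?d a (b \<oplus>\<^bsub>N\<^esub> b')) = ?\<pi> (?d a b) \<oplus>\<^bsub>tensor R M N\<^esub> ?\<pi> (?d a b')"
        using linear_maps_add[OF \<pi> b b, of a b a b'] ab b' by simp
    next
      fix a' assume a': "a' \<in> carrier M"
      have "?\<pi> (?d (a \<oplus>\<^bsub>M\<^esub> a') b) = ?\<pi> (?d a b \<oplus>\<^bsub>?F\<^esub> ?d a' b)"
        by (intro rel tensor_rels_intros F.M.a_closed b M.M.a_closed ab a')
      then show "?\<pi> (?d (a \<oplus>\<^bsub>M\<^esub> a') b) = ?\<pi> (?d a b) \<oplus>\<^bsub>tensor R M N\<^esub> ?\<pi> (?d a' b)"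
        using linear_maps_add[OF \<pi> b b, of a b a' b] ab a' by simp
    next
      fix r assume r: "r \<in> carrier R"
      have "?\<pi> (?d a (r \<odot>\<^bsub>N\<^esub> b)) = ?\<pi> (r \<odot>\<^bsub>?F\<^esub> ?d a b)"
        by (intro rel tensor_rels_intros F.smult_closed b M.smult_closed N.smult_closed ab r)
      then show "?\<pi> (?d a (r \<odot>\<^bsub>N\<^esub> b)) = r \<odot>\<^bsub>tensor R M N\<^esub> ?\<pi> (?d a b)"
        using linear_maps_smult[OF \<pi> r b, of a b] ab by simp
      have "?\<pi> (?d (r \<odot>\<^bsub>M\<^esub> a) b) = ?\<pi> (r \<odot>\<^bsub>?F\<^esub> ?d a b)"
        by (intro rel tensor_rels_intros F.smult_closed b M.smult_closed N.smult_closed ab r)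
      then show "?\<pi> (?d (r \<odot>\<^bsub>M\<^esub> a) b) = r \<odot>\<^bsub>tensor R M N\<^esub> ?\<pi> (?d a b)"
        using linear_maps_smult[OF \<pi> r b, of a b] ab by simp
    }
  qed
qed

text \<open>Uniqueness half of the universal property. Composed with the projection, both maps
  become linear on a free module whose basis vectors go to the pure tensors.\<close>

lemma tensor_ext:
  assumes M: "module R M" and N: "module R N" and P: "module R P"
    and f: "f \<in> linear_maps R (tensor R M N) P" and g: "g \<in> linear_maps R (tensor R M N) P"
    and eq: "\<And>a b. a \<in> carrier M \<Longrightarrow> b \<in> carrier N \<Longrightarrow>
      f (pure_tensor R M N a b) = g (pure_tensor R M N a b)"
    and t: "t \<in> carrier (tensor R M N)"
  shows "f t = g t"
proof -
  note \<pi> = tensor_proj_linear[OF M N]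
  obtain v where v: "v \<in> carrier (free_module R (carrier M \<times> carrier N))"
    and t_eq: "t = tensor_ker R M N +>\<^bsub>free_module R (carrier M \<times> carrier N)\<^esub> v"
    using t unfolding tensor_carrier by blast
  show ?thesis unfolding t_eq
    by (rule free_module_ext[OF P linear_maps_comp[OF f \<pi>] linear_maps_comp[OF g \<pi>] _ v])
      (use eq in \<open>auto simp: pure_tensor_def\<close>)
qed

lemma linear_maps_kernel_submodule:
  assumes M: "module R M" and N: "module R N" and f: "f \<in> linear_maps R M N"
  shows "submodule {x \<in> carrier M. f x = \<zero>\<^bsub>N\<^esub>} R M"
proof -
  interpret M: module R M by fact
  interpret N: module R N by fact
  have "f (\<ominus>\<^bsub>M\<^esub> x) = \<zero>\<^bsub>N\<^esub>" if "x \<in> carrier M" "f x = \<zero>\<^bsub>N\<^esub>" for x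
    using linear_maps_minus[OF M N f M.M.zero_closed that(1)] that
      linear_maps_zero[OF M N f] by (simp add: a_minus_def)
  then show ?thesis
    by (intro M.submoduleI)
      (auto simp: linear_maps_zero[OF M N f] linear_maps_add[OF f] linear_maps_smult[OF f])
qed

text \<open>The zero set of the extension is a submodule and contains the relations because
  \<open>\<beta>\<close> is bilinear; hence it contains the smallest such submodule.\<close>

lemma lin_ext_tensor_ker:
  assumes M: "module R M" and N: "module R N" and P: "module R P"
    and \<beta>: "\<beta> \<in> bilinear_maps R M N P" and k: "k \<in> tensor_ker R M N"
  shows "lin_ext R P (\<lambda>(a, b). \<beta> a b) k = \<zero>\<^bsub>P\<^esub>"
proof -
  interpret M: module R M by fact
  interpret N: module R N by fact
  interpret P: module R P by fact
  let ?F = "free_module R (carrier M \<times> carrier N)"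
  let ?h = "lin_ext R P (\<lambda>(a, b). \<beta> a b)"
  have F: "module R ?F" by (rule M.free_module_module)
  interpret F: module R ?F by (rule F)
  have h: "?h \<in> linear_maps R ?F P"
    by (rule lin_ext_linear[OF P]) (auto simp: bilinear_maps_closed[OF \<beta>])
  have b: "basis_vec R (a, b) \<in> carrier ?F" if "a \<in> carrier M" "b \<in> carrier N" for a b
    using that by (intro M.basis_vec_closed) simp
  have hb: "?h (basis_vec R (a, b)) = \<beta> a b" if "a \<in> carrier M" "b \<in> carrier N" for a b
    using lin_ext_basis_vec[OF P, of "\<lambda>(a, b). \<beta> a b" "(a, b)"] bilinear_maps_closed[OF \<beta> that]
    by simp
  have self: "x \<ominus>\<^bsub>P\<^esub> x = \<zero>\<^bsub>P\<^esub>" if "x \<in> carrier P" for x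
    using that by (simp add: a_minus_def P.M.r_neg)
  have "?h x = \<zero>\<^bsub>P\<^esub>" if "x \<in> tensor_rels R M N" for x
    using that unfolding tensor_rels_def Let_def
    by (elim UnE CollectE exE conjE; hypsubst;
        simp add: linear_maps_minus[OF F P h] linear_maps_add[OF h] linear_maps_smult[OF h] b hb
          linear_maps_add[OF bilinear_maps_left[OF \<beta>]] linear_maps_add[OF bilinear_maps_right[OF \<beta>]]
          linear_maps_smult[OF bilinear_maps_left[OF \<beta>]] linear_maps_smult[OF bilinear_maps_right[OF \<beta>]]
          bilinear_maps_closed[OF \<beta>] self)
  then have "tensor_ker R M N \<subseteq> {x \<in> carrier ?F. ?h x = \<zero>\<^bsub>P\<^esub>}"
    using tensor_rels_closed[OF M N] linear_maps_kernel_submodule[OF F P h]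
    unfolding tensor_ker_def span_submodule_def by (intro Inter_lower) auto
  with k show ?thesis by blast
qed

text \<open>The representative chosen inside \<open>tensor_lift\<close> differs from
  \<open>v\<close> by an element of \<open>tensor_ker\<close>, on which the linear extension
  vanishes. The existence half of the universal property follows from this.\<close>

lemma tensor_lift_proj:
  assumes M: "module R M" and N: "module R N" and P: "module R P"
    and \<beta>: "\<beta> \<in> bilinear_maps R M N P"
    and v: "v \<in> carrier (free_module R (carrier M \<times> carrier N))"
  shows "tensor_lift R P \<beta> (tensor_ker R M N +>\<^bsub>free_module R (carrier M \<times> carrier N)\<^esub> v)
    = lin_ext R P (\<lambda>(a, b). \<beta> a b) v"
proof -
  interpret M: module R M by fact
  interpret P: module R P by fact
  let ?F = "free_module R (carrier M \<times> carrier N)"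
  let ?K = "tensor_ker R M N +>\<^bsub>?F\<^esub> v"
  let ?h = "lin_ext R P (\<lambda>(a, b). \<beta> a b)"
  interpret F: module R ?F by (rule M.free_module_module)
  interpret K: abelian_subgroup "tensor_ker R M N" ?F
    by (rule F.submodule_abelian_subgroup[OF tensor_ker_submodule[OF M N]])
  have h: "?h \<in> linear_maps R ?F P"
    by (rule lin_ext_linear[OF P]) (auto simp: bilinear_maps_closed[OF \<beta>])
  have "(SOME f. f \<in> ?K) \<in> ?K"
    by (rule someI[of _ v]) (rule K.a_rcos_self[OF v])
  then obtain k where k: "k \<in> tensor_ker R M N" "(SOME f. f \<in> ?K) = k \<oplus>\<^bsub>?F\<^esub> v"
    by (auto simp: a_r_coset_def')
  show ?thesis
    unfolding tensor_lift_def k(2)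
    using lin_ext_tensor_ker[OF M N P \<beta> k(1)] linear_maps_closed[OF h v]
    by (simp add: linear_maps_add[OF h K.a_Hcarr[OF k(1)] v])
qed

lemma tensor_lift_pure_tensor:
  assumes M: "module R M" and N: "module R N" and P: "module R P"
    and \<beta>: "\<beta> \<in> bilinear_maps R M N P" and a: "a \<in> carrier M" and b: "b \<in> carrier N"
  shows "tensor_lift R P \<beta> (pure_tensor R M N a b) = \<beta> a b"
proof -
  interpret M: module R M by fact
  have "basis_vec R (a, b) \<in> carrier (free_module R (carrier M \<times> carrier N))"
    using a b by (intro M.basis_vec_closed) simp
  then show ?thesis
    unfolding pure_tensor_def
    using lin_ext_basis_vec[OF P, of "\<lambda>(a, b). \<beta> a b" "(a, b)"] bilinear_maps_closed[OF \<beta> a b]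
    by (simp add: tensor_lift_proj[OF M N P \<beta>])
qed

lemma tensor_lift_linear:
  assumes M: "module R M" and N: "module R N" and P: "module R P"
    and \<beta>: "\<beta> \<in> bilinear_maps R M N P"
  shows "tensor_lift R P \<beta> \<in> linear_maps R (tensor R M N) P"
proof -
  interpret M: module R M by fact
  let ?F = "free_module R (carrier M \<times> carrier N)"
  let ?h = "lin_ext R P (\<lambda>(a, b). \<beta> a b)"
  interpret F: module R ?F by (rule M.free_module_module)
  note \<pi> = tensor_proj_linear[OF M N]
  note lift = tensor_lift_proj[OF M N P \<beta>]
  have h: "?h \<in> linear_maps R ?F P"
    by (rule lin_ext_linear[OF P]) (auto simp: bilinear_maps_closed[OF \<beta>])
  show ?thesis
    by (rule linear_mapsI; unfold tensor_carrier; elim imageE; hypsubst)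
      (simp_all add: lift linear_maps_closed[OF h] linear_maps_add[OF h] linear_maps_smult[OF h]
        linear_maps_add[OF \<pi>, symmetric] linear_maps_smult[OF \<pi>, symmetric])
qed

lemma pure_tensor_closed:
  "module R M \<Longrightarrow> module R N \<Longrightarrow> a \<in> carrier M \<Longrightarrow> b \<in> carrier N \<Longrightarrow>
    pure_tensor R M N a b \<in> carrier (tensor R M N)"
  by (rule bilinear_maps_closed[OF pure_tensor_bilinear])

lemma
  assumes M: "module R M" and N: "module R N" and M': "module R M'" and N': "module R N'"
    and f: "f \<in> linear_maps R M M'" and g: "g \<in> linear_maps R N N'"
  shows tensor_map_linear:
      "tensor_map R M' N' f g \<in> linear_maps R (tensor R M N) (tensor R M' N')"
    and tensor_map_pure_tensor:
      "a \<in> carrier M \<Longrightarrow> b \<in> carrier N \<Longrightarrow>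
        tensor_map R M' N' f g (pure_tensor R M N a b) = pure_tensor R M' N' (f a) (g b)"
  unfolding tensor_map_def
  by (intro tensor_lift_linear tensor_lift_pure_tensor M N tensor_module M' N'
      bilinear_maps_comp[OF pure_tensor_bilinear f g]; assumption)+

text \<open>Needed because \<open>swap12\<close> and \<open>tensor_assoc\<close> nest one lift
  inside another: the outer lift must see a bilinear map, so the inner one has to be linear in its
  parameter. For fixed parameters each identity compares two linear maps in \<open>t\<close>, and
  pure tensors decide it.\<close>

lemma tensor_lift_param_linear:
  assumes M: "module R M" and N: "module R N" and P: "module R P" and Q: "module R Q"
    and \<beta>: "\<And>c. c \<in> carrier Q \<Longrightarrow> \<beta> c \<in> bilinear_maps R M N P"
    and lin: "\<And>a b. a \<in> carrier M \<Longrightarrow> b \<in> carrier N \<Longrightarrow> (\<lambda>c. \<beta> c a b) \<in> linear_maps R Q P"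
    and t: "t \<in> carrier (tensor R M N)"
  shows "(\<lambda>c. tensor_lift R P (\<beta> c) t) \<in> linear_maps R Q P"
proof (rule linear_mapsI)
  interpret Q: module R Q by fact
  note lift = tensor_lift_linear[OF M N P \<beta>]
  note pure = tensor_lift_pure_tensor[OF M N P \<beta>]
  show "tensor_lift R P (\<beta> c) t \<in> carrier P" if "c \<in> carrier Q" for c
    by (rule linear_maps_closed[OF lift[OF that] t])
  show "tensor_lift R P (\<beta> (c \<oplus>\<^bsub>Q\<^esub> d)) t = tensor_lift R P (\<beta> c) t \<oplus>\<^bsub>P\<^esub> tensor_lift R P (\<beta> d) t"
    if cd: "c \<in> carrier Q" "d \<in> carrier Q" for c d
    by (rule tensor_ext[OF M N P lift linear_maps_plus[OF P lift lift] _ t])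
      (use cd in \<open>simp_all add: pure linear_maps_add[OF lin]\<close>)
  show "tensor_lift R P (\<beta> (r \<odot>\<^bsub>Q\<^esub> c)) t = r \<odot>\<^bsub>P\<^esub> tensor_lift R P (\<beta> c) t"
    if rc: "r \<in> carrier R" "c \<in> carrier Q" for r c
    by (rule tensor_ext[OF M N P lift linear_maps_scale[OF P lift] _ t])
      (use rc in \<open>simp_all add: pure linear_maps_smult[OF lin]\<close>)
qed

section \<open>Threefold tensors, transposition and reassociation\<close>

lemma
  assumes A: "module R A"
  shows tensor3_module: "module R (tensor3 R A)"
    and pure_tensor3_linear1: "b \<in> carrier A \<Longrightarrow> c \<in> carrier A \<Longrightarrow>
      (\<lambda>a. pure_tensor3 R A a b c) \<in> linear_maps R A (tensor3 R A)"
    and pure_tensor3_linear2: "a \<in> carrier A \<Longrightarrow> c \<in> carrier A \<Longrightarrow>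
      (\<lambda>b. pure_tensor3 R A a b c) \<in> linear_maps R A (tensor3 R A)"
    and pure_tensor3_linear3: "a \<in> carrier A \<Longrightarrow> b \<in> carrier A \<Longrightarrow>
      (\<lambda>c. pure_tensor3 R A a b c) \<in> linear_maps R A (tensor3 R A)"
    and pure_tensor3_closed: "a \<in> carrier A \<Longrightarrow> b \<in> carrier A \<Longrightarrow> c \<in> carrier A \<Longrightarrow>
      pure_tensor3 R A a b c \<in> carrier (tensor3 R A)"
  unfolding tensor3_def pure_tensor3_def
  by (intro tensor_module A bilinear_maps_left[OF pure_tensor_bilinear]
      linear_maps_comp[OF bilinear_maps_right[OF pure_tensor_bilinear]
        bilinear_maps_left[OF pure_tensor_bilinear]]
      linear_maps_comp[OF bilinear_maps_right[OF pure_tensor_bilinear]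
        bilinear_maps_right[OF pure_tensor_bilinear]] pure_tensor_closed; assumption)+

lemma
  assumes A: "module R A"
  shows swap12_linear: "swap12 R A \<in> linear_maps R (tensor3 R A) (tensor3 R A)"
    and swap12_pure_tensor3: "a \<in> carrier A \<Longrightarrow> b \<in> carrier A \<Longrightarrow> c \<in> carrier A \<Longrightarrow>
      swap12 R A (pure_tensor3 R A a b c) = pure_tensor3 R A b a c"
proof -
  let ?\<beta> = "\<lambda>a b c. pure_tensor3 R A b a c"
  let ?\<gamma> = "\<lambda>a t. tensor_lift R (tensor3 R A) (?\<beta> a) t"
  have \<beta>: "?\<beta> a \<in> bilinear_maps R A A (tensor3 R A)" if "a \<in> carrier A" for a
    using that by (intro bilinear_mapsI pure_tensor3_linear1[OF A] pure_tensor3_linear3[OF A])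
  \<comment> \<open>Linear in \<open>t\<close> because it is a lift, and in \<open>a\<close> by the
    parameter lemma; this is what licenses the outer lift.\<close>
  have \<gamma>: "?\<gamma> \<in> bilinear_maps R A (tensor R A A) (tensor3 R A)"
    by (rule bilinear_mapsI, rule tensor_lift_linear[OF A A tensor3_module[OF A] \<beta>], assumption,
        rule tensor_lift_param_linear[OF A A tensor3_module[OF A] A \<beta> pure_tensor3_linear2[OF A]])
  show "swap12 R A \<in> linear_maps R (tensor3 R A) (tensor3 R A)"
    unfolding swap12_def
    by (subst (2) tensor3_def) (intro tensor_lift_linear A tensor_module \<gamma> tensor3_module)
  show "swap12 R A (pure_tensor3 R A a b c) = pure_tensor3 R A b a c"
    if "a \<in> carrier A" "b \<in> carrier A" "c \<in> carrier A"
    unfolding swap12_def pure_tensor3_def[of R A a b c] using that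
    by (simp add: tensor_lift_pure_tensor[OF A tensor_module[OF A A] tensor3_module[OF A] \<gamma>]
        tensor_lift_pure_tensor[OF A A tensor3_module[OF A] \<beta>] pure_tensor_closed[OF A A])
qed

lemma
  assumes A: "module R A"
  shows tensor_assoc_linear:
      "tensor_assoc R A \<in> linear_maps R (tensor R (tensor R A A) A) (tensor3 R A)"
    and tensor_assoc_pure_tensor: "a \<in> carrier A \<Longrightarrow> b \<in> carrier A \<Longrightarrow> c \<in> carrier A \<Longrightarrow>
      tensor_assoc R A (pure_tensor R (tensor R A A) A (pure_tensor R A A a b) c)
        = pure_tensor3 R A a b c"
proof -
  let ?\<beta> = "\<lambda>c a b. pure_tensor3 R A a b c"
  let ?\<gamma> = "\<lambda>t c. tensor_lift R (tensor3 R A) (?\<beta> c) t"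
  have \<beta>: "?\<beta> c \<in> bilinear_maps R A A (tensor3 R A)" if "c \<in> carrier A" for c
    using that by (intro bilinear_mapsI pure_tensor3_linear1[OF A] pure_tensor3_linear2[OF A])
  have \<gamma>: "?\<gamma> \<in> bilinear_maps R (tensor R A A) A (tensor3 R A)"
    by (rule bilinear_mapsI,
        rule tensor_lift_param_linear[OF A A tensor3_module[OF A] A \<beta> pure_tensor3_linear3[OF A]],
        assumption+, rule tensor_lift_linear[OF A A tensor3_module[OF A] \<beta>])
  show "tensor_assoc R A \<in> linear_maps R (tensor R (tensor R A A) A) (tensor3 R A)"
    unfolding tensor_assoc_def
    by (intro tensor_lift_linear A tensor_module \<gamma> tensor3_module)
  show "tensor_assoc R A (pure_tensor R (tensor R A A) A (pure_tensor R A A a b) c)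
      = pure_tensor3 R A a b c"
    if "a \<in> carrier A" "b \<in> carrier A" "c \<in> carrier A"
    unfolding tensor_assoc_def using that
    by (simp add: tensor_lift_pure_tensor[OF tensor_module[OF A A] A tensor3_module[OF A] \<gamma>]
        tensor_lift_pure_tensor[OF A A tensor3_module[OF A] \<beta>] pure_tensor_closed[OF A A])
qed

text \<open>Linearity in the argument is what lets the pre-Lie identity be tested on basis
  words.\<close>

lemma coassociator_linear:
  assumes A: "module R A" and \<rho>: "\<rho> \<in> linear_maps R A (tensor R A A)"
  shows "coassociator R A \<rho> \<in> linear_maps R A (tensor3 R A)"
proof -
  have "tensor_map R A (tensor R A A) (\<lambda>x. x) \<rho> \<in> linear_maps R (tensor R A A) (tensor3 R A)"
    unfolding tensor3_def
    by (intro tensor_map_linear A tensor_module linear_maps_id \<rho>)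
  moreover have "tensor_map R (tensor R A A) A \<rho> (\<lambda>x. x)
      \<in> linear_maps R (tensor R A A) (tensor R (tensor R A A) A)"
    by (intro tensor_map_linear A tensor_module linear_maps_id \<rho>)
  ultimately show ?thesis
    unfolding coassociator_def
    by (intro linear_maps_diff A tensor3_module linear_maps_comp[OF _ \<rho>]
        linear_maps_comp[OF tensor_assoc_linear[OF A]])
qed

section \<open>Splittings of words\<close>

text \<open>A simple cut with its pieces kept as words: \<open>p @ s \<noteq> []\<close> stands for
  \<open>(i, j) \<noteq> (1, length w + 1)\<close>. The length of \<open>p\<close> still records the
  position, so repeated factors are counted separately.\<close>

definition word_splits :: "'a list set \<Rightarrow> 'a list \<Rightarrow> ('a list \<times> 'a list \<times> 'a list) set"
  where "word_splits L w = {(p, u, s). w = p @ u @ s \<and> u \<in> L \<and> p @ s \<noteq> []}"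

text \<open>The factor \<open>u\<close> lies to the left of \<open>v\<close>, so an unordered pair
  of disjoint occurrences is listed once; the gap \<open>m\<close> may be empty.
  \<open>p @ m @ s \<noteq> []\<close> says that the second cut is proper; the first is proper
  because the other factor, a non-empty word, is still there.\<close>

definition disjoint_splits ::
    "'a list set \<Rightarrow> 'a list \<Rightarrow> ('a list \<times> 'a list \<times> 'a list \<times> 'a list \<times> 'a list) set"
  where "disjoint_splits L w =
    {(p, u, m, v, s). w = p @ u @ m @ v @ s \<and> u \<in> L \<and> v \<in> L \<and> p @ m @ s \<noteq> []}"

text \<open>The index set of the cancelling terms. Membership is stated for \<open>x @ y\<close>,
  the factor seen once \<open>u\<close> is gone; the other iterated coproduct sees
  \<open>x @ u @ y\<close>, and stability translates. Non-empty \<open>x\<close> and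
  \<open>y\<close> keep these terms apart from the disjoint and from the prefix and suffix
  cases.\<close>

definition nested_splits ::
    "'a list set \<Rightarrow> 'a list \<Rightarrow> ('a list \<times> 'a list \<times> 'a list \<times> 'a list \<times> 'a list) set"
  where "nested_splits L w =
    {(p, x, u, y, s). w = p @ x @ u @ y @ s \<and> u \<in> L \<and> x @ y \<in> L \<and> x \<noteq> [] \<and> y \<noteq> [] \<and> p @ s \<noteq> []}"

text \<open>All three memberships are listed so that the set serves both orders of splitting
  \<open>u @ v\<close>, whichever factor comes off first.\<close>

definition adjacent_splits ::
    "'a list set \<Rightarrow> 'a list \<Rightarrow> ('a list \<times> 'a list \<times> 'a list \<times> 'a list) set"
  where "adjacent_splits L w =
    {(p, u, v, s). w = p @ u @ v @ s \<and> u \<in> L \<and> v \<in> L \<and> u @ v \<in> L \<and> p @ s \<noteq> []}"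

text \<open>Disjointness of images is easier to decide on larger domains described by non-emptiness
  alone, where it is a mere comparison of lists.\<close>

lemma image_disjoint_mono: "f ` A \<inter> g ` B = {} \<Longrightarrow> C \<subseteq> A \<Longrightarrow> D \<subseteq> B \<Longrightarrow> f ` C \<inter> g ` D = {}"
  by blast

lemma finite_word_splits: "finite (word_splits L w)"
  and finite_disjoint_splits: "finite (disjoint_splits L w)"
  and finite_adjacent_splits: "finite (adjacent_splits L w)"
proof -
  \<comment> \<open>Every component of a splitting is a word in the letters of \<open>w\<close>, no
    longer than \<open>w\<close>, and there are finitely many of those.\<close>
  let ?X = "{xs. set xs \<subseteq> set w \<and> length xs \<le> length w}"
  have "finite ?X"
    by (simp add: finite_lists_length_le)
  moreover have "word_splits L w \<subseteq> ?X \<times> ?X \<times> ?X"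
      "disjoint_splits L w \<subseteq> ?X \<times> ?X \<times> ?X \<times> ?X \<times> ?X"
      "adjacent_splits L w \<subseteq> ?X \<times> ?X \<times> ?X \<times> ?X"
    by (auto simp: word_splits_def disjoint_splits_def adjacent_splits_def)
  ultimately show "finite (word_splits L w)" "finite (disjoint_splits L w)"
      "finite (adjacent_splits L w)"
    by (meson finite_SigmaI finite_subset)+
qed

lemma word_splits_factor:
  "(p, u, s) \<in> word_splits L w \<Longrightarrow> L \<subseteq> nonempty_words \<A> \<Longrightarrow> u \<in> nonempty_words \<A>"
  by (auto simp: word_splits_def)

lemma word_splits_remainder:
  "(p, u, s) \<in> word_splits L w \<Longrightarrow> w \<in> nonempty_words \<A> \<Longrightarrow> p @ s \<in> nonempty_words \<A>"
  by (auto simp: word_splits_def nonempty_words_def)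

lemma disjoint_splits_words:
  assumes "(p, u, m, v, s) \<in> disjoint_splits L w" "L \<subseteq> nonempty_words \<A>" "w \<in> nonempty_words \<A>"
  shows "u \<in> nonempty_words \<A>" "v \<in> nonempty_words \<A>" "p @ m @ s \<in> nonempty_words \<A>"
  using assms by (auto simp: disjoint_splits_def nonempty_words_def)

lemma nested_splits_words:
  assumes "(p, x, u, y, s) \<in> nested_splits L w" "L \<subseteq> nonempty_words \<A>" "w \<in> nonempty_words \<A>"
  shows "u \<in> nonempty_words \<A>" "x @ y \<in> nonempty_words \<A>" "p @ s \<in> nonempty_words \<A>"
  using assms by (auto simp: nested_splits_def nonempty_words_def)

lemma adjacent_splits_words:
  assumes "(p, u, v, s) \<in> adjacent_splits L w" "L \<subseteq> nonempty_words \<A>" "w \<in> nonempty_words \<A>"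
  shows "u \<in> nonempty_words \<A>" "v \<in> nonempty_words \<A>" "p @ s \<in> nonempty_words \<A>"
  using assms by (auto simp: adjacent_splits_def nonempty_words_def)

lemma simple_cuts_eq_image:
  assumes "[] \<notin> L"
  shows "simple_cuts L w = (\<lambda>(p, u, s). (length p + 1, length p + length u + 1)) ` word_splits L w"
    (is "_ = ?h ` _")
proof (intro equalityI subsetI)
  fix c assume "c \<in> simple_cuts L w"
  then obtain i j where c: "c = (i, j)" and ij: "1 \<le> i" "i < j" "j \<le> length w + 1"
    "(i, j) \<noteq> (1, length w + 1)" "subword w i j \<in> L"
    by (auto simp: simple_cuts_def)
  \<comment> \<open>Positions start at 1, so \<open>i - 1\<close> letters precede the factor and
    \<open>j - 1\<close> letters precede the suffix.\<close>
  let ?p = "take (i - 1) w" and ?u = "take (j - i) (drop (i - 1) w)" and ?s = "drop (j - 1) w"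
  have "drop (j - i) (drop (i - 1) w) = ?s"
    using ij by (simp add: drop_drop)
  then have "w = ?p @ ?u @ ?s"
    by (metis append_take_drop_id)
  moreover have "?p @ ?s \<noteq> []"
    using ij by auto
  ultimately have "(?p, ?u, ?s) \<in> word_splits L w"
    using ij(5) unfolding word_splits_def subword_def by blast
  moreover have "c = ?h (?p, ?u, ?s)"
    using ij c by (auto simp: min_def)
  ultimately show "c \<in> ?h ` word_splits L w"
    by blast
next
  fix c assume "c \<in> ?h ` word_splits L w"
  then show "c \<in> simple_cuts L w"
    \<comment> \<open>The removed factor is non-empty, which gives \<open>i < j\<close>.\<close>
    using assms by (auto simp: word_splits_def simple_cuts_def subword_def)
qed

lemma subword_split: "subword (p @ u @ s) (length p + 1) (length p + length u + 1) = u"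
  and remaining_word_split:
    "remaining_word (p @ u @ s) (length p + 1) (length p + length u + 1) = p @ s"
  by (simp_all add: subword_def remaining_word_def)

section \<open>Rearranging sums over pairs of cuts\<close>

lemma (in abelian_monoid) finsum_Sigma:
  assumes "finite A" "\<And>x. x \<in> A \<Longrightarrow> finite (B x)" "f \<in> Sigma A B \<rightarrow> carrier G"
  shows "(\<Oplus>z\<in>Sigma A B. f z) = (\<Oplus>x\<in>A. \<Oplus>y\<in>B x. f (x, y))"
  using assms
proof (induction A rule: finite_induct)
  case empty
  show ?case by simp
next
  case (insert x A)
  have eq: "Sigma (insert x A) B = Pair x ` B x \<union> Sigma A B"
    by auto
  have fx: "(\<lambda>y. f (x, y)) \<in> B x \<rightarrow> carrier G" and fA: "f \<in> Sigma A B \<rightarrow> carrier G"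
    and fS: "(\<lambda>x. \<Oplus>y\<in>B x. f (x, y)) \<in> A \<rightarrow> carrier G"
    using insert.prems(2) by (auto intro!: finsum_closed simp: Pi_def)
  have "(\<Oplus>z\<in>Sigma (insert x A) B. f z) = (\<Oplus>z\<in>Pair x ` B x. f z) \<oplus> (\<Oplus>z\<in>Sigma A B. f z)"
    unfolding eq using insert fx fA
    by (intro finsum_Un_disjoint finite_imageI finite_SigmaI) (auto simp: Pi_def)
  also have "(\<Oplus>z\<in>Pair x ` B x. f z) = (\<Oplus>y\<in>B x. f (x, y))"
    using fx by (intro finsum_reindex) (auto simp: inj_on_def)
  also have "(\<Oplus>z\<in>Sigma A B. f z) = (\<Oplus>x\<in>A. \<Oplus>y\<in>B x. f (x, y))"
    using insert fA by simp
  finally show ?case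
    using insert.hyps fx fS by (simp add: finsum_insert finsum_closed)
qed

text \<open>The shape shared by both iterated coproducts: \<open>h0\<close> enumerates the
  cancelling terms, while \<open>h1\<close> and \<open>h2\<close> turn one index \<open>d\<close>
  into the two orders of the same pair. Adding these two terms under one index is what later makes
  each summand symmetric.\<close>

lemma (in abelian_monoid) finsum_three_images:
  assumes Q: "Q = h1 ` D \<union> h2 ` D \<union> h0 ` S" and fin: "finite Q"
    and f: "f \<in> Q \<rightarrow> carrier G"
    and inj: "inj_on h0 S" "inj_on h1 D" "inj_on h2 D"
    and disj: "h1 ` D \<inter> h2 ` D = {}" "h1 ` D \<inter> h0 ` S = {}" "h2 ` D \<inter> h0 ` S = {}"
  shows "(\<Oplus>z\<in>Q. f z) = (\<Oplus>d\<in>D. f (h1 d) \<oplus> f (h2 d)) \<oplus> (\<Oplus>x\<in>S. f (h0 x))"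
proof -
  have fin': "finite (h0 ` S)" "finite (h1 ` D)" "finite (h2 ` D)"
    using fin unfolding Q by auto
  have f': "f \<in> h0 ` S \<rightarrow> carrier G" "f \<in> h1 ` D \<rightarrow> carrier G" "f \<in> h2 ` D \<rightarrow> carrier G"
    using f unfolding Q by auto
  have "(\<Oplus>z\<in>Q. f z) = ((\<Oplus>z\<in>h1 ` D. f z) \<oplus> (\<Oplus>z\<in>h2 ` D. f z)) \<oplus> (\<Oplus>z\<in>h0 ` S. f z)"
    unfolding Q using fin' f' disj
    by (subst finsum_Un_disjoint; (subst finsum_Un_disjoint)?) (auto simp: Int_Un_distrib2)
  also have "\<dots> = ((\<Oplus>d\<in>D. f (h1 d)) \<oplus> (\<Oplus>d\<in>D. f (h2 d))) \<oplus> (\<Oplus>x\<in>S. f (h0 x))"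
    using f' inj by (simp add: finsum_reindex)
  also have "(\<Oplus>d\<in>D. f (h1 d)) \<oplus> (\<Oplus>d\<in>D. f (h2 d)) = (\<Oplus>d\<in>D. f (h1 d) \<oplus> f (h2 d))"
    using f' by (intro finsum_addf[symmetric]) auto
  finally show "(\<Oplus>z\<in>Q. f z) = (\<Oplus>d\<in>D. f (h1 d) \<oplus> f (h2 d)) \<oplus> (\<Oplus>x\<in>S. f (h0 x))" .
qed

text \<open>The position of the gap left by \<open>u\<close> relative to the next factor
  \<open>u'\<close> decides everything: outside \<open>u'\<close> it gives two disjoint factors of
  \<open>w\<close>, strictly inside it a nested pair. \<open>T\<close> is kept abstract, so the
  argument is purely about words and involves no subtraction.\<close>

lemma (in abelian_monoid) finsum_splits_of_remainder:
  assumes L: "L \<subseteq> nonempty_words \<A>" and w: "w \<in> nonempty_words \<A>"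
    and T: "\<And>u v x. u \<in> nonempty_words \<A> \<Longrightarrow> v \<in> nonempty_words \<A> \<Longrightarrow> x \<in> nonempty_words \<A> \<Longrightarrow>
      T u v x \<in> carrier G"
  shows "(\<Oplus>c\<in>word_splits L w. case c of (p, u, s) \<Rightarrow>
        \<Oplus>c\<in>word_splits L (p @ s). case c of (p', u', s') \<Rightarrow> T u u' (p' @ s'))
      = (\<Oplus>c\<in>disjoint_splits L w. case c of (p, u, m, v, s) \<Rightarrow>
          T u v (p @ m @ s) \<oplus> T v u (p @ m @ s))
        \<oplus> (\<Oplus>c\<in>nested_splits L w. case c of (p, x, u, y, s) \<Rightarrow> T u (x @ y) (p @ s))"
proof -
  let ?B = "\<lambda>(p, u, s). word_splits L (p @ s)"
  let ?Q = "Sigma (word_splits L w) ?B"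
  let ?f = "\<lambda>((p, u, s), (p', u', s')). T u u' (p' @ s')"
  \<comment> \<open>The first triple is the first cut, the second triple the cut of what remains.
    \<open>h1\<close> removes the left factor first, \<open>h2\<close> the right one, and
    \<open>h0\<close> the factor between \<open>x\<close> and \<open>y\<close>.\<close>
  let ?h0 = "\<lambda>(p, x, u, y, s). ((p @ x, u, y @ s), (p, x @ y, s))"
  let ?h1 = "\<lambda>(p, u, m, v, s). ((p, u, m @ v @ s), (p @ m, v, s))"
  let ?h2 = "\<lambda>(p, u, m, v, s). ((p @ u @ m, v, s), (p, u, m @ s))"
  have nil: "u \<noteq> []" if "u \<in> L" for u
    using L that by (auto simp: nonempty_words_def)
  have cases: "z \<in> ?h1 ` disjoint_splits L w \<union> ?h2 ` disjoint_splits L w \<union> ?h0 ` nested_splits L w"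
    if z: "z \<in> ?Q" for z
  proof -
    obtain p u s p' u' s' where z_eq: "z = ((p, u, s), (p', u', s'))" and w_eq: "w = p @ u @ s"
      and uL: "u \<in> L" and ps: "p @ s = p' @ u' @ s'" and u'L: "u' \<in> L" and ne: "p' @ s' \<noteq> []"
      using z by (auto simp: word_splits_def)
    \<comment> \<open>Comparing two factorisations of one word: the gap lies at or before the start
      of \<open>u'\<close>, at or after its end, or strictly inside. A gap at an end of
      \<open>u'\<close> belongs to the first two cases, hence the non-empty \<open>x\<close> and
      \<open>y\<close> in the third.\<close>
    consider (1) m where "p' = p @ m" "s = m @ u' @ s'"
      | (2) m where "p = p' @ u' @ m" "s' = m @ s"
      | (3) x y where "p = p' @ x" "u' = x @ y" "s = y @ s'" "x \<noteq> []" "y \<noteq> []"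
      using ps by (fastforce simp: append_eq_append_conv2)
    then show ?thesis
    proof cases
      case 1
      then have "(p, u, m, u', s') \<in> disjoint_splits L w"
        using w_eq uL u'L ne by (auto simp: disjoint_splits_def)
      then show ?thesis
        using 1 z_eq by force
    next
      case 2
      then have "(p', u', m, u, s) \<in> disjoint_splits L w"
        using w_eq uL u'L ne by (auto simp: disjoint_splits_def)
      then show ?thesis
        using 2 z_eq by force
    next
      case 3
      then have "(p', x, u, y, s') \<in> nested_splits L w"
        using w_eq uL u'L ne by (auto simp: nested_splits_def)
      then show ?thesis
        using 3 z_eq by force
    qed
  qed
  have Q: "?Q = ?h1 ` disjoint_splits L w \<union> ?h2 ` disjoint_splits L w \<union> ?h0 ` nested_splits L w"
  proof (intro equalityI subsetI cases)
    fix z assume "z \<in> ?h1 ` disjoint_splits L w \<union> ?h2 ` disjoint_splits L w \<union> ?h0 ` nested_splits L w"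
    then show "z \<in> ?Q"
      using nil by (auto simp: word_splits_def disjoint_splits_def nested_splits_def)
  qed assumption
  have fin: "finite ?Q"
    by (intro finite_SigmaI) (auto intro: finite_word_splits)
  have f: "?f \<in> ?Q \<rightarrow> carrier G"
    using w L by (auto intro!: T intro: word_splits_factor word_splits_remainder)
  have inj: "inj_on ?h0 (nested_splits L w)" "inj_on ?h1 (disjoint_splits L w)"
      "inj_on ?h2 (disjoint_splits L w)"
    by (auto simp: inj_on_def)
  have sub: "disjoint_splits L w \<subseteq> {(p, u, m, v, s). u \<noteq> [] \<and> v \<noteq> []}"
      "nested_splits L w \<subseteq> {(p, x, u, y, s). x \<noteq> [] \<and> y \<noteq> []}"
    using nil by (auto simp: disjoint_splits_def nested_splits_def)
  \<comment> \<open>Prefix and suffix lengths separate the images. In \<open>h1\<close> the first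
    prefix is at most as long as the second, in \<open>h2\<close> and \<open>h0\<close> it is
    strictly longer; these two differ because the first suffix is strictly longer than the second in
    \<open>h0\<close> but not in \<open>h2\<close>.\<close>
  have disj': "?h1 ` {(p, u, m, v, s). u \<noteq> [] \<and> v \<noteq> []} \<inter> ?h2 ` {(p, u, m, v, s). u \<noteq> [] \<and> v \<noteq> []} = {}"
      "?h1 ` {(p, u, m, v, s). u \<noteq> [] \<and> v \<noteq> []} \<inter> ?h0 ` {(p, x, u, y, s). x \<noteq> [] \<and> y \<noteq> []} = {}"
      "?h2 ` {(p, u, m, v, s). u \<noteq> [] \<and> v \<noteq> []} \<inter> ?h0 ` {(p, x, u, y, s). x \<noteq> [] \<and> y \<noteq> []} = {}"
    by auto
  have disj: "?h1 ` disjoint_splits L w \<inter> ?h2 ` disjoint_splits L w = {}"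
      "?h1 ` disjoint_splits L w \<inter> ?h0 ` nested_splits L w = {}"
      "?h2 ` disjoint_splits L w \<inter> ?h0 ` nested_splits L w = {}"
    by (rule image_disjoint_mono[OF disj'(1) sub(1) sub(1)]
        image_disjoint_mono[OF disj'(2) sub(1) sub(2)] image_disjoint_mono[OF disj'(3) sub(1) sub(2)])+
  note three = finsum_three_images[OF Q fin f inj disj]
  have "(\<Oplus>c\<in>word_splits L w. case c of (p, u, s) \<Rightarrow>
        \<Oplus>c\<in>word_splits L (p @ s). case c of (p', u', s') \<Rightarrow> T u u' (p' @ s'))
      = (\<Oplus>c\<in>word_splits L w. \<Oplus>d\<in>?B c. ?f (c, d))"
    by (simp add: case_prod_unfold)
  \<comment> \<open>One sum over dependent pairs is needed, since the three cases cut across the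
    outer index.\<close>
  also have "\<dots> = (\<Oplus>z\<in>?Q. ?f z)"
    by (rule finsum_Sigma[symmetric]) (use f in \<open>auto intro: finite_word_splits\<close>)
  finally show "(\<Oplus>c\<in>word_splits L w. case c of (p, u, s) \<Rightarrow>
        \<Oplus>c\<in>word_splits L (p @ s). case c of (p', u', s') \<Rightarrow> T u u' (p' @ s'))
      = (\<Oplus>c\<in>disjoint_splits L w. case c of (p, u, m, v, s) \<Rightarrow>
          T u v (p @ m @ s) \<oplus> T v u (p @ m @ s))
        \<oplus> (\<Oplus>c\<in>nested_splits L w. case c of (p, x, u, y, s) \<Rightarrow> T u (x @ y) (p @ s))"
    unfolding three by (simp add: case_prod_unfold)
qed

text \<open>Stability freed of indices, applied to the cut that removes the middle factor;
  \<open>x @ y \<noteq> []\<close> makes that cut proper.\<close>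

lemma stable_set_insert_iff:
  assumes stable: "stable_set \<A> L" and w: "x @ u @ y \<in> nonempty_words \<A>"
    and u: "u \<in> L" and ne: "x @ y \<noteq> []"
  shows "x @ u @ y \<in> L \<longleftrightarrow> x @ y \<in> L"
proof -
  let ?c = "(length x + 1, length x + length u + 1)"
  have "[] \<notin> L"
    using stable by (auto simp: stable_set_def nonempty_words_def)
  moreover have "(x, u, y) \<in> word_splits L (x @ u @ y)"
    using u ne by (simp add: word_splits_def)
  ultimately have "?c \<in> simple_cuts L (x @ u @ y)"
    by (subst simple_cuts_eq_image) force+
  then show ?thesis
    using stable w remaining_word_split[of x u y] unfolding stable_set_def by fastforce
qed

text \<open>Within the removed factor \<open>x @ v @ y\<close> the second cut takes a prefix, a
  suffix or an interior factor. Stability moves membership in \<open>L\<close> from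
  \<open>x @ v @ y\<close> to \<open>x @ y\<close>; for interior \<open>v\<close> this makes the
  index set literally the one found for the remainder, as the cancellation requires.\<close>

lemma (in abelian_monoid) finsum_splits_of_factor:
  assumes stable: "stable_set \<A> L" and w: "w \<in> nonempty_words \<A>"
    and T: "\<And>u v x. u \<in> nonempty_words \<A> \<Longrightarrow> v \<in> nonempty_words \<A> \<Longrightarrow> x \<in> nonempty_words \<A> \<Longrightarrow>
      T u v x \<in> carrier G"
  shows "(\<Oplus>c\<in>word_splits L w. case c of (p, u, s) \<Rightarrow>
        \<Oplus>c\<in>word_splits L u. case c of (x, v, y) \<Rightarrow> T v (x @ y) (p @ s))
      = (\<Oplus>c\<in>adjacent_splits L w. case c of (p, u, v, s) \<Rightarrow> T u v (p @ s) \<oplus> T v u (p @ s))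
        \<oplus> (\<Oplus>c\<in>nested_splits L w. case c of (p, x, u, y, s) \<Rightarrow> T u (x @ y) (p @ s))"
proof -
  let ?B = "\<lambda>(p, u, s). word_splits L u"
  let ?Q = "Sigma (word_splits L w) ?B"
  let ?f = "\<lambda>((p, u, s), (x, v, y)). T v (x @ y) (p @ s)"
  let ?h0 = "\<lambda>(p, x, u, y, s). ((p, x @ u @ y, s), (x, u, y))"
  \<comment> \<open>Both start from the removed factor \<open>u @ v\<close>: \<open>h1\<close> takes
    off the prefix \<open>u\<close> and leaves \<open>v\<close>, \<open>h2\<close> takes off the
    suffix \<open>v\<close> and leaves \<open>u\<close>.\<close>
  let ?h1 = "\<lambda>(p, u, v, s). ((p, u @ v, s), ([], u, v))"
  let ?h2 = "\<lambda>(p, u, v, s). ((p, u @ v, s), (u, v, []))"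
  have L: "L \<subseteq> nonempty_words \<A>"
    using stable by (simp add: stable_set_def)
  have nil: "u \<noteq> []" if "u \<in> L" for u
    using L that by (auto simp: nonempty_words_def)
  \<comment> \<open>As a factor of \<open>w\<close>, the word \<open>x @ u @ y\<close> is over the
    alphabet, where stability is available.\<close>
  have iff: "x @ u @ y \<in> L \<longleftrightarrow> x @ y \<in> L"
    if "w = p @ x @ u @ y @ s" "u \<in> L" "x @ y \<noteq> []" for p x u y s
    using that w by (intro stable_set_insert_iff[OF stable]) (auto simp: nonempty_words_def)
  have cases: "z \<in> ?h1 ` adjacent_splits L w \<union> ?h2 ` adjacent_splits L w \<union> ?h0 ` nested_splits L w"
    if z: "z \<in> ?Q" for z
  proof -
    obtain p s x v y where z_eq: "z = ((p, x @ v @ y, s), (x, v, y))"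
      and w_eq: "w = p @ x @ v @ y @ s" and uL: "x @ v @ y \<in> L" and vL: "v \<in> L"
      and ne: "x @ y \<noteq> []" "p @ s \<noteq> []"
      using z by (auto simp: word_splits_def)
    have xy: "x @ y \<in> L"
      using iff[OF w_eq vL ne(1)] uL by simp
    consider (1) "x = []" | (2) "y = []" | (3) "x \<noteq> []" "y \<noteq> []"
      by blast
    then show ?thesis
    proof cases
      case 1
      then have "(p, v, y, s) \<in> adjacent_splits L w"
        using w_eq uL vL xy ne by (simp add: adjacent_splits_def)
      then show ?thesis
        using 1 z_eq by force
    next
      case 2
      then have "(p, x, v, s) \<in> adjacent_splits L w"
        using w_eq uL vL xy ne by (simp add: adjacent_splits_def)
      then show ?thesis
        using 2 z_eq by force
    next
      case 3
      then have "(p, x, v, y, s) \<in> nested_splits L w"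
        using w_eq vL xy ne by (simp add: nested_splits_def)
      then show ?thesis
        using z_eq by force
    qed
  qed
  have Q: "?Q = ?h1 ` adjacent_splits L w \<union> ?h2 ` adjacent_splits L w \<union> ?h0 ` nested_splits L w"
  proof (intro equalityI subsetI cases)
    fix z assume "z \<in> ?h1 ` adjacent_splits L w \<union> ?h2 ` adjacent_splits L w \<union> ?h0 ` nested_splits L w"
    then show "z \<in> ?Q"
      \<comment> \<open>Here stability is used in the inserting direction: \<open>x @ y\<close> in
        \<open>L\<close> puts \<open>x @ u @ y\<close> in \<open>L\<close>, so the outer cut of a
        nested splitting is legitimate.\<close>
      using nil iff by (fastforce simp: word_splits_def adjacent_splits_def nested_splits_def)
  qed assumption
  have fin: "finite ?Q"
    by (intro finite_SigmaI) (auto intro: finite_word_splits)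
  have f: "?f \<in> ?Q \<rightarrow> carrier G"
    using w L by (auto intro!: T intro: word_splits_factor word_splits_remainder)
  have inj: "inj_on ?h0 (nested_splits L w)" "inj_on ?h1 (adjacent_splits L w)"
      "inj_on ?h2 (adjacent_splits L w)"
    by (auto simp: inj_on_def)
  have sub: "adjacent_splits L w \<subseteq> {(p, u, v, s). u \<noteq> [] \<and> v \<noteq> []}"
      "nested_splits L w \<subseteq> {(p, x, u, y, s). x \<noteq> [] \<and> y \<noteq> []}"
    using nil by (auto simp: adjacent_splits_def nested_splits_def)
  \<comment> \<open>The inner prefix is empty only in \<open>h1\<close>, the inner suffix only in
    \<open>h2\<close>.\<close>
  have disj': "?h1 ` {(p, u, v, s). u \<noteq> [] \<and> v \<noteq> []} \<inter> ?h2 ` {(p, u, v, s). u \<noteq> [] \<and> v \<noteq> []} = {}"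
      "?h1 ` {(p, u, v, s). u \<noteq> [] \<and> v \<noteq> []} \<inter> ?h0 ` {(p, x, u, y, s). x \<noteq> [] \<and> y \<noteq> []} = {}"
      "?h2 ` {(p, u, v, s). u \<noteq> [] \<and> v \<noteq> []} \<inter> ?h0 ` {(p, x, u, y, s). x \<noteq> [] \<and> y \<noteq> []} = {}"
    by auto
  have disj: "?h1 ` adjacent_splits L w \<inter> ?h2 ` adjacent_splits L w = {}"
      "?h1 ` adjacent_splits L w \<inter> ?h0 ` nested_splits L w = {}"
      "?h2 ` adjacent_splits L w \<inter> ?h0 ` nested_splits L w = {}"
    by (rule image_disjoint_mono[OF disj'(1) sub(1) sub(1)]
        image_disjoint_mono[OF disj'(2) sub(1) sub(2)] image_disjoint_mono[OF disj'(3) sub(1) sub(2)])+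
  note three = finsum_three_images[OF Q fin f inj disj]
  have "(\<Oplus>c\<in>word_splits L w. case c of (p, u, s) \<Rightarrow>
        \<Oplus>c\<in>word_splits L u. case c of (x, v, y) \<Rightarrow> T v (x @ y) (p @ s))
      = (\<Oplus>c\<in>word_splits L w. \<Oplus>d\<in>?B c. ?f (c, d))"
    by (simp add: case_prod_unfold)
  also have "\<dots> = (\<Oplus>z\<in>?Q. ?f z)"
    by (rule finsum_Sigma[symmetric]) (use f in \<open>auto intro: finite_word_splits\<close>)
  finally show "(\<Oplus>c\<in>word_splits L w. case c of (p, u, s) \<Rightarrow>
        \<Oplus>c\<in>word_splits L u. case c of (x, v, y) \<Rightarrow> T v (x @ y) (p @ s))
      = (\<Oplus>c\<in>adjacent_splits L w. case c of (p, u, v, s) \<Rightarrow> T u v (p @ s) \<oplus> T v u (p @ s))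
        \<oplus> (\<Oplus>c\<in>nested_splits L w. case c of (p, x, u, y, s) \<Rightarrow> T u (x @ y) (p @ s))"
    unfolding three by (simp add: case_prod_unfold)
qed

section \<open>The comultiplication on words\<close>

text \<open>Carries the sum from positions, as in the definition of \<open>rho\<close>, to
  factorisations. No term is lost or repeated, because the two lengths determine how
  \<open>w\<close> is cut.\<close>

lemma (in abelian_monoid) finsum_simple_cuts:
  assumes nil: "[] \<notin> L"
    and F: "\<And>p u s. (p, u, s) \<in> word_splits L w \<Longrightarrow> F u (p @ s) \<in> carrier G"
  shows "(\<Oplus>c\<in>simple_cuts L w. case c of (i, j) \<Rightarrow> F (subword w i j) (remaining_word w i j))
    = (\<Oplus>c\<in>word_splits L w. case c of (p, u, s) \<Rightarrow> F u (p @ s))"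
proof -
  let ?h = "\<lambda>(p, u, s). (length p + 1, length p + length u + 1)"
  let ?f = "\<lambda>(i, j). F (subword w i j) (remaining_word w i j)"
  have h: "?f (?h c) = (case c of (p, u, s) \<Rightarrow> F u (p @ s))" if "c \<in> word_splits L w" for c
    using that by (auto simp: word_splits_def subword_split[simplified] remaining_word_split[simplified])
  have "inj_on ?h (word_splits L w)"
    by (auto simp: inj_on_def word_splits_def append_eq_append_conv)
  moreover have closed: "?f \<in> ?h ` word_splits L w \<rightarrow> carrier G"
    using F by (intro Pi_I, elim imageE) (simp only: h, auto)
  ultimately have "(\<Oplus>c\<in>simple_cuts L w. ?f c) = (\<Oplus>c\<in>word_splits L w. ?f (?h c))"
    unfolding simple_cuts_eq_image[OF nil] by (intro finsum_reindex)
  also have "\<dots> = (\<Oplus>c\<in>word_splits L w. case c of (p, u, s) \<Rightarrow> F u (p @ s))"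
    using F by (intro finsum_cong' h) auto
  finally show ?thesis .
qed

lemma word_module_module: "cring R \<Longrightarrow> module R (word_module R \<A>)"
  unfolding word_module_def by (rule cring.free_module_module)

lemma word_module_ext:
  assumes "module R M"
    and "f \<in> linear_maps R (word_module R \<A>) M" and "g \<in> linear_maps R (word_module R \<A>) M"
    and "\<And>w. w \<in> nonempty_words \<A> \<Longrightarrow> f (basis_vec R w) = g (basis_vec R w)"
    and "v \<in> carrier (word_module R \<A>)"
  shows "f v = g v"
  using assms unfolding word_module_def by (rule free_module_ext)

lemma basis_vec_word_module:
  "cring R \<Longrightarrow> w \<in> nonempty_words \<A> \<Longrightarrow> basis_vec R w \<in> carrier (word_module R \<A>)"
  unfolding word_module_def by (rule cring.basis_vec_closed)

lemma
  fixes R :: "('r, 'q) ring_scheme" and \<A> :: "'a set" and L :: "'a list set"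
  assumes R: "cring R" and L: "L \<subseteq> nonempty_words \<A>"
  defines "V \<equiv> word_module R \<A>"
  shows rho_linear: "rho R \<A> L \<in> linear_maps R V (tensor R V V)"
    and rho_basis_vec: "w \<in> nonempty_words \<A> \<Longrightarrow> rho R \<A> L (basis_vec R w) =
      (\<Oplus>\<^bsub>tensor R V V\<^esub> c\<in>word_splits L w. case c of (p, u, s) \<Rightarrow>
        pure_tensor R V V (basis_vec R u) (basis_vec R (p @ s)))"
proof -
  let ?F = "\<lambda>u x. pure_tensor R V V (basis_vec R u) (basis_vec R x)"
  let ?\<phi> = "\<lambda>w. \<Oplus>\<^bsub>tensor R V V\<^esub> c \<in> simple_cuts L w. case c of (i, j) \<Rightarrow>
    ?F (subword w i j) (remaining_word w i j)"
  let ?\<psi> = "\<lambda>w. \<Oplus>\<^bsub>tensor R V V\<^esub> c\<in>word_splits L w. case c of (p, u, s) \<Rightarrow> ?F u (p @ s)"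
  have V: "module R V"
    unfolding V_def by (rule word_module_module[OF R])
  have VV: "module R (tensor R V V)"
    by (rule tensor_module[OF V V])
  interpret VV: module R "tensor R V V" by (rule VV)
  have F: "?F u (p @ s) \<in> carrier (tensor R V V)"
    if "(p, u, s) \<in> word_splits L w" "w \<in> nonempty_words \<A>" for p u s w
    using word_splits_factor[OF that(1) L] word_splits_remainder[OF that] unfolding V_def
    by (intro pure_tensor_closed basis_vec_word_module R V[unfolded V_def])
  have \<psi>: "?\<psi> w \<in> carrier (tensor R V V)" if "w \<in> nonempty_words \<A>" for w
    by (rule VV.M.finsum_closed) (use F[OF _ that] in \<open>auto simp: Pi_def\<close>)
  have \<phi>: "?\<phi> w = ?\<psi> w" if "w \<in> nonempty_words \<A>" for w
    by (rule VV.M.finsum_simple_cuts) (use F[OF _ that] L in \<open>auto simp: nonempty_words_def\<close>)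
  have rho: "rho R \<A> L = lin_ext R (tensor R V V) ?\<phi>"
    unfolding rho_def V_def Let_def ..
  show "rho R \<A> L \<in> linear_maps R V (tensor R V V)"
    unfolding rho by (subst (2) V_def, unfold word_module_def, rule lin_ext_linear[OF VV])
      (simp add: \<phi> \<psi>)
  show "rho R \<A> L (basis_vec R w) = ?\<psi> w" if w: "w \<in> nonempty_words \<A>"
    using lin_ext_basis_vec[OF VV, of ?\<phi> w] \<phi>[OF w] \<psi>[OF w] unfolding rho by simp
qed

text \<open>The single device for expanding iterated coproducts: \<open>f\<close> will be a whole
  map such as \<open>id \<otimes> \<rho>\<close>, or the insertion of the argument into one slot of
  a larger tensor.\<close>

lemma linear_maps_rho_basis_vec:
  assumes R: "cring R" and L: "L \<subseteq> nonempty_words \<A>" and P: "module R P"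
    and f: "f \<in> linear_maps R (tensor R (word_module R \<A>) (word_module R \<A>)) P"
    and w: "w \<in> nonempty_words \<A>"
  shows "f (rho R \<A> L (basis_vec R w)) = (\<Oplus>\<^bsub>P\<^esub> c\<in>word_splits L w. case c of (p, u, s) \<Rightarrow>
    f (pure_tensor R (word_module R \<A>) (word_module R \<A>) (basis_vec R u) (basis_vec R (p @ s))))"
proof -
  let ?V = "word_module R \<A>"
  have V: "module R ?V"
    by (rule word_module_module[OF R])
  have "(\<lambda>(p, u, s). pure_tensor R ?V ?V (basis_vec R u) (basis_vec R (p @ s)))
      \<in> word_splits L w \<rightarrow> carrier (tensor R ?V ?V)"
    using w L by (auto intro!: pure_tensor_closed basis_vec_word_module V R
        intro: word_splits_factor word_splits_remainder)
  then show ?thesis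
    unfolding rho_basis_vec[OF R L w]
    by (subst linear_maps_finsum[OF tensor_module[OF V V] P f finite_word_splits])
      (simp_all add: case_prod_unfold)
qed

text \<open>Both sums are stated with the two orders added inside each summand, the shape in which
  invariance under the swap can be checked term by term.\<close>

lemma coassociator_rho_basis_vec:
  fixes R :: "('r, 'q) ring_scheme" and \<A> :: "'a set" and L :: "'a list set"
  assumes R: "cring R" and stable: "stable_set \<A> L" and w: "w \<in> nonempty_words \<A>"
  defines "V \<equiv> word_module R \<A>"
  defines "T \<equiv> \<lambda>u v x. pure_tensor3 R V (basis_vec R u) (basis_vec R v) (basis_vec R x)"
  shows "coassociator R V (rho R \<A> L) (basis_vec R w) =
    (\<Oplus>\<^bsub>tensor3 R V\<^esub> c\<in>disjoint_splits L w. case c of (p, u, m, v, s) \<Rightarrow>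
      T u v (p @ m @ s) \<oplus>\<^bsub>tensor3 R V\<^esub> T v u (p @ m @ s))
    \<ominus>\<^bsub>tensor3 R V\<^esub> (\<Oplus>\<^bsub>tensor3 R V\<^esub> c\<in>adjacent_splits L w. case c of (p, u, v, s) \<Rightarrow>
      T u v (p @ s) \<oplus>\<^bsub>tensor3 R V\<^esub> T v u (p @ s))"
proof -
  let ?\<rho> = "rho R \<A> L" and ?e = "basis_vec R" and ?W = "nonempty_words \<A>"
  let ?V2 = "tensor R V V" and ?V3 = "tensor3 R V"
  have L: "L \<subseteq> ?W"
    using stable by (simp add: stable_set_def)
  have V: "module R V"
    unfolding V_def by (rule word_module_module[OF R])
  have V2: "module R ?V2" and V3: "module R ?V3"
    by (intro tensor_module tensor3_module V)+
  interpret V3: module R ?V3 by (rule V3)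
  have e: "?e u \<in> carrier V" if "u \<in> ?W" for u
    unfolding V_def by (rule basis_vec_word_module[OF R that])
  have \<rho>: "?\<rho> \<in> linear_maps R V ?V2"
    unfolding V_def by (rule rho_linear[OF R L])
  note \<rho>_apply = linear_maps_rho_basis_vec[OF R L, folded V_def]
  have T: "T u v x \<in> carrier ?V3" if "u \<in> ?W" "v \<in> ?W" "x \<in> ?W" for u v x
    unfolding T_def by (intro pure_tensor3_closed V e that)
  let ?D = "\<Oplus>\<^bsub>?V3\<^esub> c\<in>disjoint_splits L w. case c of (p, u, m, v, s) \<Rightarrow>
      T u v (p @ m @ s) \<oplus>\<^bsub>?V3\<^esub> T v u (p @ m @ s)"
  let ?E = "\<Oplus>\<^bsub>?V3\<^esub> c\<in>adjacent_splits L w. case c of (p, u, v, s) \<Rightarrow>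
      T u v (p @ s) \<oplus>\<^bsub>?V3\<^esub> T v u (p @ s)"
  let ?N = "\<Oplus>\<^bsub>?V3\<^esub> c\<in>nested_splits L w. case c of (p, x, u, y, s) \<Rightarrow> T u (x @ y) (p @ s)"
  have inner1: "tensor_map R V ?V2 (\<lambda>x. x) ?\<rho> (pure_tensor R V V (?e u) (?e (p @ s)))
      = (\<Oplus>\<^bsub>?V3\<^esub> c\<in>word_splits L (p @ s). case c of (p', u', s') \<Rightarrow> T u u' (p' @ s'))"
    if "(p, u, s) \<in> word_splits L w" for p u s
  proof -
    have u: "u \<in> ?W" and ps: "p @ s \<in> ?W"
      using that L w by (auto intro: word_splits_factor word_splits_remainder)
    have "tensor_map R V ?V2 (\<lambda>x. x) ?\<rho> (pure_tensor R V V (?e u) (?e (p @ s)))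
        = pure_tensor R V ?V2 (?e u) (?\<rho> (?e (p @ s)))"
      by (intro tensor_map_pure_tensor V V2 linear_maps_id \<rho> e u ps)
    \<comment> \<open>With \<open>u\<close> fixed, a pure tensor is linear in its right slot, so the
      coproduct of the remainder can be expanded inside it.\<close>
    also have "\<dots> = (\<Oplus>\<^bsub>?V3\<^esub> c\<in>word_splits L (p @ s). case c of (p', u', s') \<Rightarrow> T u u' (p' @ s'))"
      unfolding T_def pure_tensor3_def tensor3_def
      by (intro \<rho>_apply bilinear_maps_right[OF pure_tensor_bilinear] V V2 tensor_module e u ps)
    finally show ?thesis .
  qed
  have inner2: "tensor_assoc R V (tensor_map R ?V2 V ?\<rho> (\<lambda>x. x) (pure_tensor R V V (?e u) (?e (p @ s))))
      = (\<Oplus>\<^bsub>?V3\<^esub> c\<in>word_splits L u. case c of (x, v, y) \<Rightarrow> T v (x @ y) (p @ s))"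
    if "(p, u, s) \<in> word_splits L w" for p u s
  proof -
    have u: "u \<in> ?W" and ps: "p @ s \<in> ?W"
      using that L w by (auto intro: word_splits_factor word_splits_remainder)
    have "tensor_map R ?V2 V ?\<rho> (\<lambda>x. x) (pure_tensor R V V (?e u) (?e (p @ s)))
        = pure_tensor R ?V2 V (?\<rho> (?e u)) (?e (p @ s))"
      by (intro tensor_map_pure_tensor V V2 linear_maps_id \<rho> e u ps)
    \<comment> \<open>Insertion into the left slot followed by reassociation is one linear map, so
      the coproduct of \<open>u\<close> can be expanded under both at once.\<close>
    moreover have "(\<lambda>t. tensor_assoc R V (pure_tensor R ?V2 V t (?e (p @ s))))
        \<in> linear_maps R ?V2 ?V3"
      by (intro linear_maps_comp[OF tensor_assoc_linear[OF V]]
          bilinear_maps_left[OF pure_tensor_bilinear] V V2 e ps)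
    note \<rho>_apply[OF V3 this u]
    moreover have "(\<Oplus>\<^bsub>?V3\<^esub> c\<in>word_splits L u. case c of (x, v, y) \<Rightarrow>
          tensor_assoc R V (pure_tensor R ?V2 V (pure_tensor R V V (?e v) (?e (x @ y))) (?e (p @ s))))
        = (\<Oplus>\<^bsub>?V3\<^esub> c\<in>word_splits L u. case c of (x, v, y) \<Rightarrow> T v (x @ y) (p @ s))"
    proof (intro V3.M.finsum_cong' refl)
      show "(\<lambda>(x, v, y). T v (x @ y) (p @ s)) \<in> word_splits L u \<rightarrow> carrier ?V3"
        using u ps L by (auto intro!: T intro: word_splits_factor word_splits_remainder)
    next
      fix c assume c: "c \<in> word_splits L u"
      obtain x v y where c_eq: "c = (x, v, y)"
        by (cases c)
      have "v \<in> ?W" "x @ y \<in> ?W"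
        using c u L unfolding c_eq by (auto intro: word_splits_factor word_splits_remainder)
      then show "(case c of (x, v, y) \<Rightarrow>
          tensor_assoc R V (pure_tensor R ?V2 V (pure_tensor R V V (?e v) (?e (x @ y))) (?e (p @ s))))
          = (case c of (x, v, y) \<Rightarrow> T v (x @ y) (p @ s))"
        unfolding c_eq T_def by (simp add: tensor_assoc_pure_tensor[OF V] e ps)
    qed
    ultimately show ?thesis by simp
  qed
  have left: "tensor_map R V ?V2 (\<lambda>x. x) ?\<rho> (?\<rho> (?e w)) = ?D \<oplus>\<^bsub>?V3\<^esub> ?N"
  proof -
    have map: "tensor_map R V ?V2 (\<lambda>x. x) ?\<rho> \<in> linear_maps R ?V2 ?V3"
      unfolding tensor3_def by (intro tensor_map_linear V V2 linear_maps_id \<rho>)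
    have "tensor_map R V ?V2 (\<lambda>x. x) ?\<rho> (?\<rho> (?e w)) =
        (\<Oplus>\<^bsub>?V3\<^esub> c\<in>word_splits L w. case c of (p, u, s) \<Rightarrow>
          \<Oplus>\<^bsub>?V3\<^esub> c\<in>word_splits L (p @ s). case c of (p', u', s') \<Rightarrow> T u u' (p' @ s'))"
      unfolding \<rho>_apply[OF V3 map w]
      using w L by (intro V3.M.finsum_cong') (auto simp: inner1 intro!: V3.M.finsum_closed T
          intro: word_splits_factor word_splits_remainder)
    also have "\<dots> = ?D \<oplus>\<^bsub>?V3\<^esub> ?N"
      by (rule V3.M.finsum_splits_of_remainder[OF L w T])
    finally show ?thesis .
  qed
  have right: "tensor_assoc R V (tensor_map R ?V2 V ?\<rho> (\<lambda>x. x) (?\<rho> (?e w))) = ?E \<oplus>\<^bsub>?V3\<^esub> ?N"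
  proof -
    have map: "(\<lambda>t. tensor_assoc R V (tensor_map R ?V2 V ?\<rho> (\<lambda>x. x) t)) \<in> linear_maps R ?V2 ?V3"
      by (intro linear_maps_comp[OF tensor_assoc_linear[OF V]] tensor_map_linear V V2 linear_maps_id \<rho>)
    have "tensor_assoc R V (tensor_map R ?V2 V ?\<rho> (\<lambda>x. x) (?\<rho> (?e w))) =
        (\<Oplus>\<^bsub>?V3\<^esub> c\<in>word_splits L w. case c of (p, u, s) \<Rightarrow>
          \<Oplus>\<^bsub>?V3\<^esub> c\<in>word_splits L u. case c of (x, v, y) \<Rightarrow> T v (x @ y) (p @ s))"
      unfolding \<rho>_apply[OF V3 map w]
      using w L by (intro V3.M.finsum_cong') (auto simp: inner2 intro!: V3.M.finsum_closed T
          intro: word_splits_factor word_splits_remainder)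
    also have "\<dots> = ?E \<oplus>\<^bsub>?V3\<^esub> ?N"
      by (rule V3.M.finsum_splits_of_factor[OF stable w T])
    finally show ?thesis .
  qed
  have D: "?D \<in> carrier ?V3"
    by (intro V3.M.finsum_closed) (auto intro!: V3.M.a_closed T dest: disjoint_splits_words[OF _ L w])
  have E: "?E \<in> carrier ?V3"
    by (intro V3.M.finsum_closed) (auto intro!: V3.M.a_closed T dest: adjacent_splits_words[OF _ L w])
  have N: "?N \<in> carrier ?V3"
    by (intro V3.M.finsum_closed) (auto intro!: T dest: nested_splits_words[OF _ L w])
  \<comment> \<open>The same nested sum has come out of both iterated coproducts and drops out
    here.\<close>
  have "(?D \<oplus>\<^bsub>?V3\<^esub> ?N) \<ominus>\<^bsub>?V3\<^esub> (?E \<oplus>\<^bsub>?V3\<^esub> ?N) = ?D \<ominus>\<^bsub>?V3\<^esub> ?E"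
    using D E N by (simp add: a_minus_def V3.M.minus_add V3.M.a_ac V3.M.r_neg V3.M.r_neg1 V3.M.r_neg2)
  then show ?thesis
    unfolding coassociator_def left right .
qed

section \<open>Invariance under the swap\<close>

lemma
  assumes A: "module R A" and C: "finite C"
    and abx: "\<And>c. c \<in> C \<Longrightarrow> a c \<in> carrier A \<and> b c \<in> carrier A \<and> x c \<in> carrier A"
  defines "S \<equiv> \<Oplus>\<^bsub>tensor3 R A\<^esub> c\<in>C.
    pure_tensor3 R A (a c) (b c) (x c) \<oplus>\<^bsub>tensor3 R A\<^esub> pure_tensor3 R A (b c) (a c) (x c)"
  shows symmetrized_sum_closed: "S \<in> carrier (tensor3 R A)"
    and swap12_symmetrized_sum: "swap12 R A S = S"
proof -
  let ?V3 = "tensor3 R A" and ?T = "pure_tensor3 R A"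
  let ?g = "\<lambda>c. ?T (a c) (b c) (x c) \<oplus>\<^bsub>?V3\<^esub> ?T (b c) (a c) (x c)"
  have V3: "module R ?V3"
    by (rule tensor3_module[OF A])
  interpret V3: module R ?V3 by (rule V3)
  note swap = swap12_linear[OF A] and T = pure_tensor3_closed[OF A]
  have g: "?g \<in> C \<rightarrow> carrier ?V3"
    using abx by (auto intro!: V3.M.a_closed T)
  then show "S \<in> carrier ?V3"
    unfolding S_def by (rule V3.M.finsum_closed)
  \<comment> \<open>The swap exchanges the two terms inside one summand, so the sum is not
    reindexed.\<close>
  have "swap12 R A (?g c) = ?g c" if "c \<in> C" for c
    using abx[OF that]
    by (simp add: linear_maps_add[OF swap T T] swap12_pure_tensor3[OF A] V3.M.a_comm T)
  then show "swap12 R A S = S"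
    unfolding S_def linear_maps_finsum[OF V3 V3 swap C g] by (intro V3.M.finsum_cong' g) auto
qed

theorem theorem3p3p1:
  fixes R :: "('r, 'q) ring_scheme" and \<A> :: "'a set" and L :: "'a list set"
  assumes "cring R"
    and "stable_set \<A> L"
  shows "pre_Lie_comultiplication R (word_module R \<A>) (rho R \<A> L)"
proof -
  let ?V = "word_module R \<A>"
  let ?V3 = "tensor3 R ?V" and ?W = "nonempty_words \<A>" and ?ca = "coassociator R ?V (rho R \<A> L)"
  let ?T = "\<lambda>u v x. pure_tensor3 R ?V (basis_vec R u) (basis_vec R v) (basis_vec R x)"
  have L: "L \<subseteq> ?W"
    using assms(2) by (simp add: stable_set_def)
  have V: "module R ?V"
    by (rule word_module_module[OF assms(1)])
  have V3: "module R ?V3"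
    by (rule tensor3_module[OF V])
  have \<rho>: "rho R \<A> L \<in> linear_maps R ?V (tensor R ?V ?V)"
    by (rule rho_linear[OF assms(1) L])
  note ca = coassociator_linear[OF V \<rho>]
  note swap = swap12_linear[OF V]
  have basis: "swap12 R ?V (?ca (basis_vec R w)) = ?ca (basis_vec R w)" if w: "w \<in> ?W" for w
  proof -
    let ?D = "\<Oplus>\<^bsub>?V3\<^esub> c\<in>disjoint_splits L w. case c of (p, u, m, v, s) \<Rightarrow>
      ?T u v (p @ m @ s) \<oplus>\<^bsub>?V3\<^esub> ?T v u (p @ m @ s)"
    let ?E = "\<Oplus>\<^bsub>?V3\<^esub> c\<in>adjacent_splits L w. case c of (p, u, v, s) \<Rightarrow>
      ?T u v (p @ s) \<oplus>\<^bsub>?V3\<^esub> ?T v u (p @ s)"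
    note sym = symmetrized_sum_closed[OF V] swap12_symmetrized_sum[OF V]
    have D: "?D \<in> carrier ?V3" "swap12 R ?V ?D = ?D"
    proof -
      \<comment> \<open>The three families read the two removed factors and the final remainder off
        the index, which puts the sum into the symmetrised form.\<close>
      let ?a = "\<lambda>(p, u, m, v, s). basis_vec R u" and ?b = "\<lambda>(p, u, m, v, s). basis_vec R v"
        and ?x = "\<lambda>(p, u, m, v, s). basis_vec R (p @ m @ s)"
      have "?a c \<in> carrier ?V \<and> ?b c \<in> carrier ?V \<and> ?x c \<in> carrier ?V"
        if "c \<in> disjoint_splits L w" for c
        using that by (cases c) (auto intro!: basis_vec_word_module assms(1)
            dest: disjoint_splits_words[OF _ L w])
      from sym[OF finite_disjoint_splits this]
      show "?D \<in> carrier ?V3" "swap12 R ?V ?D = ?D"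
        by (simp_all add: case_prod_unfold)
    qed
    have E: "?E \<in> carrier ?V3" "swap12 R ?V ?E = ?E"
    proof -
      let ?a = "\<lambda>(p, u, v, s). basis_vec R u" and ?b = "\<lambda>(p, u, v, s). basis_vec R v"
        and ?x = "\<lambda>(p, u, v, s). basis_vec R (p @ s)"
      have "?a c \<in> carrier ?V \<and> ?b c \<in> carrier ?V \<and> ?x c \<in> carrier ?V"
        if "c \<in> adjacent_splits L w" for c
        using that by (cases c) (auto intro!: basis_vec_word_module assms(1)
            dest: adjacent_splits_words[OF _ L w])
      from sym[OF finite_adjacent_splits this]
      show "?E \<in> carrier ?V3" "swap12 R ?V ?E = ?E"
        by (simp_all add: case_prod_unfold)
    qed
    show ?thesis
      unfolding coassociator_rho_basis_vec[OF assms w] linear_maps_minus[OF V3 V3 swap D(1) E(1)] D(2) E(2) ..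
  qed
  \<comment> \<open>Both sides are linear in \<open>a\<close>, so agreement on basis words
    suffices.\<close>
  have "swap12 R ?V (?ca a) = ?ca a" if "a \<in> carrier ?V" for a
    by (rule word_module_ext[OF V3 linear_maps_comp[OF swap ca] ca basis that])
  then show ?thesis
    unfolding pre_Lie_comultiplication_def comultiplication_def using V \<rho> by blast
qed

end
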